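(* Let $\mu\in\mathbb{R}$, $\sigma>0$, let $(W_s)_{s\ge 0}$ be a standard Brownian motion, and for $t\ge 0$ let $I_t=\int_0^t e^{-(\mu s+\sigma W_s)}\,ds$. Let $F(t,y)=P(I_t\le y)$ be the cumulative distribution function of $I_t$, let $\bar F(t,y)=1-F(t,y)$ for $t>0$, $y\ge 0$, and for $\lambda>0$ let $$P(y,\lambda)=\int_0^\infty e^{-\lambda t}\,\bar F(t,y)\,dt .$$ Set $b=\mu+\frac{\sigma^2}{2}$. Then for every $\lambda>0$, the function $y\mapsto P(y,\lambda)$ satisfies the differential equation $$\frac{1}{2}\sigma^2 y^2 P''_{yy}+(by-1)P'_y-\lambda P=0$$ with boundary conditions $$P(0,\lambda)=\frac{1}{\lambda},\qquad \lim_{y\to+\infty}P(y,\lambda)=0,$$ and explicitly, for $y>0$, $$P(y,\lambda)=\frac{1}{\lambda}\left(\frac{2}{y\sigma^2}\right)^{k}\frac{\Gamma\!\left(1-\frac{2\mu}{\sigma^2}+k\right)}{\Gamma\!\left(1-\frac{2\mu}{\sigma^2}+2k\right)}\,M\!\left(k,\,1-\frac{2\mu}{\sigma^2}+2k,\,-\frac{2}{y\sigma^2}\right),$$ where $k=\frac{\mu+\sqrt{\mu^2+2\lambda\sigma^2}}{\sigma^2}$.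
   Context: $M$ denotes Kummer's confluent hypergeometric function of the first kind, $M(a,b,z)=\sum_{n=0}^\infty\frac{(a)_n z^n}{(b)_n\, n!}$, where $(a)_0=1$ and $(a)_n=a(a+1)\cdots(a+n-1)$ is the Pochhammer symbol (similarly for $(b)_n$). $\Gamma$ is the Gamma function. Primes denote derivatives with respect to $y$. *)

theory Defs
  imports "HOL-Probability.Probability"
begin

definition std_brownian_motion :: "'a measure \<Rightarrow> (real \<Rightarrow> 'a \<Rightarrow> real) \<Rightarrow> bool" where
  "std_brownian_motion M W \<longleftrightarrow>
     prob_space M \<and>
     (\<forall>t\<ge>0. W t \<in> borel_measurable M) \<and>
     (\<forall>\<omega>\<in>space M. W 0 \<omega> = 0 \<and> continuous_on {0..} (\<lambda>t. W t \<omega>)) \<and>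
     (\<forall>s t. 0 \<le> s \<and> s < t \<longrightarrow>
        distributed M lborel (\<lambda>\<omega>. W t \<omega> - W s \<omega>) (normal_density 0 (sqrt (t - s)))) \<and>
     (\<forall>(n::nat) (ts::nat \<Rightarrow> real). 0 \<le> ts 0 \<and> (\<forall>i<n. ts i < ts (Suc i)) \<longrightarrow>
        prob_space.indep_vars M (\<lambda>_. borel) (\<lambda>i \<omega>. W (ts (Suc i)) \<omega> - W (ts i) \<omega>) {..<n})"

definition kummerM :: "real \<Rightarrow> real \<Rightarrow> real \<Rightarrow> real" where
  "kummerM a b z = (\<Sum>n. pochhammer a n * z ^ n / (pochhammer b n * fact n))"

definition expfun :: "real \<Rightarrow> real \<Rightarrow> (real \<Rightarrow> 'a \<Rightarrow> real) \<Rightarrow> real \<Rightarrow> 'a \<Rightarrow> real" where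
  "expfun \<mu> \<sigma> W t \<omega> = integral {0..t} (\<lambda>s. exp (-(\<mu> * s + \<sigma> * W s \<omega>)))"

definition cdfI :: "'a measure \<Rightarrow> real \<Rightarrow> real \<Rightarrow> (real \<Rightarrow> 'a \<Rightarrow> real) \<Rightarrow> real \<Rightarrow> real \<Rightarrow> real" where
  "cdfI M \<mu> \<sigma> W t y = measure M {\<omega> \<in> space M. expfun \<mu> \<sigma> W t \<omega> \<le> y}"

definition laplP :: "'a measure \<Rightarrow> real \<Rightarrow> real \<Rightarrow> (real \<Rightarrow> 'a \<Rightarrow> real) \<Rightarrow> real \<Rightarrow> real \<Rightarrow> real" where
  "laplP M \<mu> \<sigma> W y lam = (LINT t:{0<..}|lborel. exp (-lam * t) * (1 - cdfI M \<mu> \<sigma> W t y))"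

end

theory Submission
  imports Defs "HOL-Real_Asymp.Real_Asymp"
begin

text \<open>
  Let \<open>f\<close> be \<open>\<lambda>\<close> times the claimed solution, extended by \<open>1\<close> to the nonpositive reals. Replace the
  exponential functional by its left Riemann sums \<open>J\<close> at mesh \<open>h\<close>. The rescaled remaining budget
  \<open>X = (y - J) exp (\<mu> t + \<sigma> W)\<close> is then a Markov chain with steps \<open>X \<mapsto> (X - h) exp (\<mu> h + \<sigma> N)\<close>,
  \<open>N\<close> normal with variance \<open>h\<close>, and \<open>J \<ge> y\<close> iff \<open>X \<le> 0\<close>. By Taylor's formula and the differential
  equation, \<open>exp (- \<lambda> h) E f(X')\<close> differs from \<open>f(X)\<close> by \<open>O(h powr (3/2))\<close> uniformly in \<open>X > h\<close>;
  the states \<open>0 < X \<le> h\<close> are visited at most once. Telescoping the discounted expectations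
  shows that the discrete analogue of \<open>\<lambda> P(y, \<lambda>)\<close> converges to \<open>f y\<close>, and Fatou's lemma, applied to
  the tail and to the distribution function, transfers this to the exponential functional.
  The uniformity rests on the boundedness of \<open>z powr a * M(a, b, -z)\<close> on the half-line for all
  positive \<open>a\<close> and \<open>b\<close>.
\<close>

section \<open>Kummer's function\<close>

text \<open>In continuous time the budget solves dX = (b X - 1) dt + \<sigma> X dW and reaches 0 at
  the time \<tau> when the functional reaches y. Hence \<lambda> P(y, \<lambda>) = E exp(- \<lambda>
  \<tau>), and the differential equation says that f is an eigenfunction of the generator of X. Left
  endpoints keep the discrete chain exactly Markov: each weight depends on past increments only. The
  noise acts multiplicatively, so f is expanded in log X and its derivatives must stay bounded after
  weighting with powers of x; the additive shift by h calls for unweighted bounds too. The delicate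
  place is x = 0, an irregular singular point, where M is taken at large negative arguments. An
  error of order 3/2 per step suffices because discounting leaves about 1 / (\<lambda> h) effective
  steps. Each use of Fatou's lemma yields one inequality; the one for the distribution function
  compares y with a level x > y, and continuity of f closes the gap. Differentiability of P is a
  consequence of its identification with f / \<lambda>.\<close>

lemma kummerM_summable:
  fixes a b z :: real
  assumes "a > 0" "b > 0"
  shows "summable (\<lambda>n. pochhammer a n / (pochhammer b n * fact n) * z ^ n)"
proof -
  define R where "R = 1 + a / b"
  have R: "(a + real n) / (b + real n) \<le> R" for n
  proof -
    have "a + real n \<le> (1 + a / b) * (b + real n)"
      using assms by (simp add: field_simps)
    then show ?thesis using assms by (simp add: R_def divide_le_eq)
  qed
  have "R > 0" using assms by (simp add: R_def add_pos_pos)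
  obtain N :: nat where N: "real N \<ge> 2 * R * \<bar>z\<bar>" using real_arch_simple by blast
  show ?thesis
  proof (rule summable_ratio_test[of "1/2" N])
    fix n assume n: "n \<ge> N"
    let ?f = "\<lambda>n. pochhammer a n / (pochhammer b n * fact n) * z ^ n"
    have "?f (Suc n) = (a + real n) / (b + real n) * (z / (1 + real n)) * ?f n"
      by (simp add: pochhammer_Suc field_simps)
    then have "norm (?f (Suc n)) = (a + real n) / (b + real n) * (\<bar>z\<bar> / (1 + real n)) * norm (?f n)"
      using assms by (simp add: abs_mult)
    moreover have "(a + real n) / (b + real n) * (\<bar>z\<bar> / (1 + real n)) \<le> R * (\<bar>z\<bar> / (1 + real n))"
      by (rule mult_right_mono[OF R]) simp
    moreover have "R * (\<bar>z\<bar> / (1 + real n)) \<le> 1 / 2"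
      using N n by (simp add: field_simps)
    ultimately show "norm (?f (Suc n)) \<le> 1 / 2 * norm (?f n)"
      using mult_right_mono[OF order_trans, of _ _ "1/2" "norm (?f n)"] by (simp only: norm_ge_zero)
  qed simp
qed

lemma kummerM_sums:
  fixes a b z :: real
  assumes "a > 0" "b > 0"
  shows "(\<lambda>n. pochhammer a n / (pochhammer b n * fact n) * z ^ n) sums kummerM a b z"
  using summable_sums[OF kummerM_summable[OF assms, of z]] by (simp add: kummerM_def)

lemma kummerM_0 [simp]: "kummerM a b 0 = 1"
  using powser_zero[of "\<lambda>n. pochhammer a n / (pochhammer b n * fact n)"] by (simp add: kummerM_def)

lemma pochhammer_shift:
  fixes a :: real
  assumes "a > 0"
  shows "pochhammer (a + 1) n = pochhammer a n * (a + real n) / a"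
  using pochhammer_rec[of a n] pochhammer_Suc[of a n] assms by (simp add: field_simps)

text \<open>Multiplication by \<open>z\<close> moves every coefficient one place up. This reduces
  the derivative formula and the contiguity relations to identities between coefficients of the same
  power.\<close>

lemma sums_mult_index:
  fixes c :: "nat \<Rightarrow> real"
  assumes "(\<lambda>n. c n * z ^ n) sums s"
  shows "(\<lambda>n. (case n of 0 \<Rightarrow> 0 | Suc m \<Rightarrow> c m) * z ^ n) sums (z * s)"
proof -
  have "(\<lambda>n. z * (c n * z ^ n)) sums (z * s)"
    by (rule sums_mult[OF assms])
  then have "(\<lambda>n. (case Suc n of 0 \<Rightarrow> 0 | Suc m \<Rightarrow> c m) * z ^ Suc n) sums (z * s)"
    by (simp add: mult_ac)
  from sums_Suc[OF this] show ?thesis by simp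
qed

text \<open>Since (a)_n (a + n) = a (a+1)_n, the operator z d/dz + a raises the first parameter.
  This form, unlike the usual (a/b) M(a+1, b+1, z), leaves \<open>b\<close> alone, which is what
  lets \<open>kummerG\<close> keep its second parameter under differentiation; the price is the
  division by \<open>z\<close>.\<close>

lemma kummerM_has_derivative:
  fixes a b z :: real
  assumes "a > 0" "b > 0" "z \<noteq> 0"
  shows "(kummerM a b has_real_derivative a * (kummerM (a + 1) b z - kummerM a b z) / z) (at z)"
proof -
  define c where "c = (\<lambda>n. pochhammer a n / (pochhammer b n * fact n))"
  have sc: "summable (\<lambda>n. c n * y ^ n)" for y
    unfolding c_def by (rule kummerM_summable[OF assms(1,2)])
  have eq: "kummerM a b = (\<lambda>x. \<Sum>n. c n * x ^ n)"
    by (simp add: kummerM_def c_def fun_eq_iff)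
  have d: "(kummerM a b has_real_derivative (\<Sum>n. diffs c n * z ^ n)) (at z)"
    unfolding eq by (rule termdiffs_strong_converges_everywhere[OF sc])
  have "(\<lambda>n. diffs c n * z ^ n) sums (\<Sum>n. diffs c n * z ^ n)"
    by (rule summable_sums[OF termdiff_converges_all[OF sc]])
  from sums_mult_index[OF this]
  have 1: "(\<lambda>n. real n * c n * z ^ n) sums (z * (\<Sum>n. diffs c n * z ^ n))"
    by (rule sums_cong[THEN iffD1, rotated]) (simp add: diffs_def split: nat.split)
  have 2: "(\<lambda>n. a * (pochhammer (a + 1) n / (pochhammer b n * fact n) * z ^ n - c n * z ^ n))
      sums (a * (kummerM (a + 1) b z - kummerM a b z))"
    unfolding c_def using assms by (intro sums_mult sums_diff kummerM_sums) auto
  have "z * (\<Sum>n. diffs c n * z ^ n) = a * (kummerM (a + 1) b z - kummerM a b z)"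
  proof (rule sums_unique2[OF 1])
    show "(\<lambda>n. real n * c n * z ^ n) sums (a * (kummerM (a + 1) b z - kummerM a b z))"
    proof (rule sums_cong[THEN iffD1, OF _ 2])
      fix n
      have "a * pochhammer (a + 1) n = pochhammer a n * (a + real n)"
        using assms by (simp add: pochhammer_shift)
      then have "a * (pochhammer (a + 1) n / (pochhammer b n * fact n))
          = pochhammer a n * (a + real n) / (pochhammer b n * fact n)" by simp
      then show "a * (pochhammer (a + 1) n / (pochhammer b n * fact n) * z ^ n - c n * z ^ n)
          = real n * c n * z ^ n"
        unfolding c_def right_diff_distrib mult.assoc[symmetric]
        by (simp add: algebra_simps add_divide_distrib)
    qed
  qed
  then have "(\<Sum>n. diffs c n * z ^ n) = a * (kummerM (a + 1) b z - kummerM a b z) / z"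
    using assms by (metis nonzero_mult_div_cancel_left)
  then show ?thesis using d by simp
qed

lemma kummerM_continuous:
  fixes a b z :: real
  assumes "a > 0" "b > 0"
  shows "isCont (kummerM a b) z"
proof -
  define c where "c = (\<lambda>n. pochhammer a n / (pochhammer b n * fact n))"
  have sc: "summable (\<lambda>n. c n * y ^ n)" for y
    unfolding c_def by (rule kummerM_summable[OF assms(1,2)])
  have eq: "kummerM a b = (\<lambda>x. \<Sum>n. c n * x ^ n)"
    by (simp add: kummerM_def c_def fun_eq_iff)
  show ?thesis
    unfolding eq by (rule DERIV_isCont[OF termdiffs_strong_converges_everywhere[OF sc]])
qed

text \<open>Kummer's differential equation in disguise: writing first and second derivatives through
  the raising operator turns it into a three-term relation in the first parameter. The proof
  compares coefficients.\<close>

lemma kummerM_contiguous_a: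
  fixes a b z :: real
  assumes "a > 0" "b > 0"
  shows "(b - a - 1) * kummerM a b z + (2 * a + 2 - b + z) * kummerM (a + 1) b z
           = (a + 1) * kummerM (a + 2) b z"
proof -
  define c where "c a n = pochhammer a n / (pochhammer b n * fact n)" for a n
  have s: "(\<lambda>n. c x n * z ^ n) sums kummerM x b z" if "x > 0" for x
    unfolding c_def by (rule kummerM_sums[OF that assms(2)])
  have "(\<lambda>n. (b - a - 1) * (c a n * z ^ n) + (2 * a + 2 - b) * (c (a + 1) n * z ^ n)
        + (case n of 0 \<Rightarrow> 0 | Suc m \<Rightarrow> c (a + 1) m) * z ^ n - (a + 1) * (c (a + 2) n * z ^ n))
      sums ((b - a - 1) * kummerM a b z + (2 * a + 2 - b) * kummerM (a + 1) b z
        + z * kummerM (a + 1) b z - (a + 1) * kummerM (a + 2) b z)"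
    using assms by (intro sums_add sums_diff sums_mult sums_mult_index s) auto
  moreover have "(b - a - 1) * (c a n * z ^ n) + (2 * a + 2 - b) * (c (a + 1) n * z ^ n)
        + (case n of 0 \<Rightarrow> 0 | Suc m \<Rightarrow> c (a + 1) m) * z ^ n - (a + 1) * (c (a + 2) n * z ^ n) = 0" for n
  proof -
    have c1: "c (a + 1) n = c a n * (a + real n) / a" for n
      using assms by (simp add: c_def pochhammer_shift)
    have c2: "c (a + 2) n = c a n * (a + real n) * (a + real n + 1) / (a * (a + 1))"
    proof -
      have "pochhammer (a + 2) n = pochhammer (a + 1) n * (a + 1 + real n) / (a + 1)"
        using pochhammer_shift[of "a + 1" n] assms by (simp add: add.assoc)
      then show ?thesis
        unfolding pochhammer_shift[OF assms(1)] c_def by (simp add: add_ac mult_ac)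
    qed
    \<comment> \<open>The factor \<open>real n\<close> reproduces the default coefficient 0 at
      \<open>n = 0\<close>, so one formula covers both cases.\<close>
    have c3: "(case n of 0 \<Rightarrow> 0 | Suc m \<Rightarrow> c (a + 1) m) = c a n * real n * (b + real n - 1) / a"
    proof (cases n)
      case (Suc m)
      have "pochhammer b m > 0" "b + real m > 0" using assms by (auto intro: pochhammer_pos)
      moreover have "p * s / (q * t * (u * f)) * u * t / a = p / (q * f) * s / a"
        if "t > 0" "u > 0" for p q s t u f :: real using that by simp
      from this[of "b + real m" "1 + real m" "pochhammer a m" "a + real m" "pochhammer b m" "fact m"]
      have "b + real m > 0 \<Longrightarrow> c a (Suc m) * (1 + real m) * (b + real m) / a = c a m * (a + real m) / a"
        unfolding c_def pochhammer_Suc fact_Suc by simp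
      ultimately show ?thesis unfolding Suc nat.case c1 by (auto simp: add_ac)
    qed simp
    have "(b - a - 1) * c a n + (2 * a + 2 - b) * c (a + 1) n
        + c a n * real n * (b + real n - 1) / a - (a + 1) * c (a + 2) n = 0"
    proof -
      have "(b - a - 1) * C + (2 * a + 2 - b) * (C * (a + r) / a) + C * r * (b + r - 1) / a
          = (a + r) * (a + r + 1) * C / a" for C r
        using assms by (simp add: field_simps)
      moreover have "(a + 1) * c (a + 2) n = (a + real n) * (a + real n + 1) * c a n / a"
      proof -
        have "(a + 1) * (X / (a * (a + 1))) = X / a" for X using assms by simp
        then show ?thesis unfolding c2 by (simp only: mult_ac)
      qed
      ultimately show ?thesis unfolding c1 by simp
    qed
    then have "((b - a - 1) * c a n + (2 * a + 2 - b) * c (a + 1) n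
        + c a n * real n * (b + real n - 1) / a - (a + 1) * c (a + 2) n) * z ^ n = 0" by simp
    then show ?thesis unfolding c3 by (simp only: distrib_right left_diff_distrib mult.assoc)
  qed
  ultimately have "(\<lambda>n. 0) sums ((b - a - 1) * kummerM a b z + (2 * a + 2 - b) * kummerM (a + 1) b z
        + z * kummerM (a + 1) b z - (a + 1) * kummerM (a + 2) b z)" by simp
  then have "(b - a - 1) * kummerM a b z + (2 * a + 2 - b) * kummerM (a + 1) b z
        + z * kummerM (a + 1) b z - (a + 1) * kummerM (a + 2) b z = 0"
    using sums_unique2 sums_zero by blast
  then show ?thesis by (simp add: algebra_simps)
qed

text \<open>After the common Pochhammer factors are removed, the coefficients agree by the partial
  fractions 1/((b+n) n) + 1/(b (b+n)) = 1/(b n).\<close>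

lemma kummerM_contiguous_b:
  fixes a b z :: real
  assumes "a > 0" "b > 0"
  shows "kummerM a b z = kummerM a (b + 1) z + a / (b * (b + 1)) * (z * kummerM (a + 1) (b + 2) z)"
proof -
  define c where "c a b n = pochhammer a n / (pochhammer b n * fact n)" for a b :: real and n
  have s: "(\<lambda>n. c x y n * z ^ n) sums kummerM x y z" if "x > 0" "y > 0" for x y
    unfolding c_def by (rule kummerM_sums[OF that])
  have "(\<lambda>n. c a (b + 1) n * z ^ n + a / (b * (b + 1)) *
         ((case n of 0 \<Rightarrow> 0 | Suc m \<Rightarrow> c (a + 1) (b + 2) m) * z ^ n))
      sums (kummerM a (b + 1) z + a / (b * (b + 1)) * (z * kummerM (a + 1) (b + 2) z))"
    using assms by (intro sums_add sums_mult sums_mult_index s) auto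
  moreover have "c a (b + 1) n * z ^ n + a / (b * (b + 1)) *
         ((case n of 0 \<Rightarrow> 0 | Suc m \<Rightarrow> c (a + 1) (b + 2) m) * z ^ n) = c a b n * z ^ n" for n
  proof (cases n)
    case (Suc m)
    have 1: "pochhammer a n = a * pochhammer (a + 1) m" "pochhammer b n = b * pochhammer (b + 1) m"
      unfolding Suc by (rule pochhammer_rec)+
    have 2: "pochhammer (b + 1) n = (b + 1) * pochhammer (b + 2) m"
      unfolding Suc using pochhammer_rec[of "b + 1" m] by (simp add: add_ac)
    have 3: "pochhammer (b + 1) n = pochhammer (b + 1) m * (b + real n)"
      unfolding Suc pochhammer_Suc by simp
    have p: "pochhammer (b + 1) m > 0" "b + real n > 0"
      using assms by (auto intro: pochhammer_pos)
    have 4: "(b + 1) * pochhammer (b + 2) m = pochhammer (b + 1) m * (b + real n)"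
      using 2 3 by simp
    have "c a (b + 1) n = a * pochhammer (a + 1) m / (pochhammer (b + 1) m * (b + real n) * fact n)"
      unfolding c_def 1 3 by simp
    moreover have "a / (b * (b + 1)) * c (a + 1) (b + 2) m
       = a * pochhammer (a + 1) m / (b * ((b + 1) * pochhammer (b + 2) m) * fact m)"
      unfolding c_def by simp
    moreover have "a * pochhammer (a + 1) m / (pochhammer (b + 1) m * (b + real n) * fact n)
       + a * pochhammer (a + 1) m / (b * (pochhammer (b + 1) m * (b + real n)) * fact m)
       = a * pochhammer (a + 1) m / (b * pochhammer (b + 1) m * fact n)"
    proof -
      have f: "fact n = real n * fact m" unfolding Suc by simp
      have "real n > 0" unfolding Suc by auto
      have "1 / (t * n') + 1 / (b * t) = 1 / (b * n')" if "t = b + n'" "n' > 0" for t n' :: real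
        using that assms by (simp add: divide_simps)
      from this[of "b + real n" "real n"] \<open>real n > 0\<close>
      have "a * pochhammer (a + 1) m / (pochhammer (b + 1) m * fact m) *
          (1 / ((b + real n) * real n) + 1 / (b * (b + real n)))
        = a * pochhammer (a + 1) m / (pochhammer (b + 1) m * fact m) * (1 / (b * real n))" by simp
      then show ?thesis unfolding f distrib_left by (simp add: algebra_simps)
    qed
    ultimately have "c a (b + 1) n + a / (b * (b + 1)) * c (a + 1) (b + 2) m = c a b n"
      unfolding 4 by (simp only: c_def 1)
    then show ?thesis unfolding Suc nat.case by (metis distrib_right mult.assoc)
  qed (simp add: c_def)
  ultimately have "(\<lambda>n. c a b n * z ^ n) sums 
     (kummerM a (b + 1) z + a / (b * (b + 1)) * (z * kummerM (a + 1) (b + 2) z))" by simp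
  with s[OF assms] show ?thesis by (rule sums_unique2)
qed

section \<open>Euler's integral and the behaviour of Kummer's function at minus infinity\<close>

lemma Beta_shift_real:
  fixes a q :: real
  assumes "a > 0" "q > 0"
  shows "Beta (a + real n) q = Beta a q * pochhammer a n / pochhammer (a + q) n"
proof -
  have 1: "Gamma (x + real n) = Gamma x * pochhammer x n" if "x > 0" for x :: real
  proof -
    have "x \<notin> \<int>\<^sub>\<le>\<^sub>0" using that by auto
    then show ?thesis using pochhammer_Gamma[of x n] Gamma_real_pos[OF that] by simp
  qed
  have "a + real n + q = a + q + real n" by simp
  then show ?thesis
    unfolding Beta_def using 1[OF assms(1)] 1[of "a + q"] assms by (simp only:) simp
qed

lemma has_bochner_integral_Beta:
  fixes a q :: real
  assumes "a > 0" "q > 0"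
  shows "has_bochner_integral lborel
    (\<lambda>t. indicator {0..1} t * (t powr (a - 1) * (1 - t) powr (q - 1))) (Beta a q)"
proof -
  have "(LINT t:{0..1}|lborel. t powr (a - 1) * (1 - t) powr (q - 1)) = Beta a q"
    using set_borel_integral_eq_integral(2)[OF integrable_Beta[OF assms]]
      integral_unique[OF has_integral_Beta_real[OF assms]] by simp
  then show ?thesis
    using integrable_Beta[OF assms]
    by (simp add: has_bochner_integral_iff set_integrable_def set_lebesgue_integral_def)
qed

text \<open>By \<open>Beta_shift_real\<close> the quotients of Pochhammer symbols are the normalised
  moments of the Beta density, so the Kummer series is the exponential series integrated term by
  term.\<close>

lemma kummerM_Euler_integral:
  fixes a q z :: real
  assumes "a > 0" "q > 0"
  shows "Beta a q * kummerM a (a + q) (- z) =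
    (\<integral>t. indicator {0..1} t * (exp (- z * t) * (t powr (a - 1) * (1 - t) powr (q - 1))) \<partial>lborel)"
proof -
  define g where "g n t = indicator {0..1} t * (t powr (a + real n - 1) * (1 - t) powr (q - 1))"
    for n and t :: real
  have g: "has_bochner_integral lborel (g n) (Beta (a + real n) q)" for n
    unfolding g_def using has_bochner_integral_Beta[of "a + real n" q] assms by simp
  have gp: "g n t = t ^ n * g 0 t" for n t
  proof (cases "t > 0")
    case True
    then have "t powr (a + real n - 1) = t powr (a - 1) * t ^ n"
      using powr_add[of t "a - 1" "real n"] by (simp add: powr_realpow algebra_simps)
    then show ?thesis by (simp add: g_def)
  \<comment> \<open>At \<open>t = 0\<close> both sides vanish because \<open>0 powr x = 0\<close>;
    for negative \<open>t\<close> the indicator does it.\<close>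
  qed (auto simp: g_def indicator_def)
  define f where "f n t = (- z) ^ n / fact n * g n t" for n t
  have f: "has_bochner_integral lborel (f n) ((- z) ^ n / fact n * Beta (a + real n) q)" for n
    unfolding f_def by (intro has_bochner_integral_mult_right g)
  have nf: "has_bochner_integral lborel (\<lambda>t. norm (f n t)) (\<bar>z\<bar> ^ n / fact n * Beta (a + real n) q)" for n
  proof -
    have "norm (f n t) = \<bar>z\<bar> ^ n / fact n * g n t" for t
      by (simp add: f_def abs_mult power_abs g_def)
    then show ?thesis by (simp only:) (intro has_bochner_integral_mult_right g)
  qed
  have fs: "f n t = (- z * t) ^ n /\<^sub>R fact n * g 0 t" for n t
    unfolding f_def gp[of n] using power_mult_distrib[of "- z" t n] by (simp add: divide_inverse)
  have sums: "(\<lambda>n. f n t) sums (exp (- z * t) * g 0 t)" for t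
    unfolding fs by (intro sums_mult2 exp_converges)
  have "(\<lambda>n. integral\<^sup>L lborel (f n)) sums (\<integral>t. (\<Sum>n. f n t) \<partial>lborel)"
  proof (rule sums_integral)
    show "integrable lborel (f n)" for n using f[of n] by (rule integrable.intros)
    have "summable (\<lambda>n. norm (f n t))" for t
    proof -
      have "norm (f n t) = norm ((- z * t) ^ n /\<^sub>R fact n) * \<bar>g 0 t\<bar>" for n
        unfolding fs by (simp add: abs_mult)
      then show ?thesis
        by (simp only:) (intro summable_mult2 summable_norm_exp)
    qed
    then show "AE t in lborel. summable (\<lambda>n. norm (f n t))" by simp
    \<comment> \<open>The integrals of the norms form the Kummer series at \<bar>z\<bar>, which
      justifies the interchange.\<close>
    have "summable (\<lambda>n. Beta a q * (pochhammer a n / (pochhammer (a + q) n * fact n) * \<bar>z\<bar> ^ n))"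
      using assms by (intro summable_mult kummerM_summable) auto
    then show "summable (\<lambda>n. LINT t|lborel. norm (f n t))"
      unfolding has_bochner_integral_integral_eq[OF nf] Beta_shift_real[OF assms]
      by (simp add: mult_ac)
  qed
  moreover have "(\<lambda>n. integral\<^sup>L lborel (f n)) sums (Beta a q * kummerM a (a + q) (- z))"
  proof -
    have "(\<lambda>n. Beta a q * (pochhammer a n / (pochhammer (a + q) n * fact n) * (- z) ^ n))
        sums (Beta a q * kummerM a (a + q) (- z))"
      using assms by (intro sums_mult kummerM_sums) auto
    then show ?thesis
      unfolding has_bochner_integral_integral_eq[OF f] Beta_shift_real[OF assms]
      by (simp add: mult_ac)
  qed
  ultimately have "Beta a q * kummerM a (a + q) (- z) = (\<integral>t. (\<Sum>n. f n t) \<partial>lborel)"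
    using sums_unique2 by blast
  also have "(\<lambda>t. \<Sum>n. f n t) = (\<lambda>t. exp (- z * t) * g 0 t)"
    using sums sums_unique by (metis (no_types, lifting))
  finally show ?thesis by (simp add: g_def mult_ac)
qed

text \<open>The substitution s = z t absorbs the factor \<open>z powr a\<close>; what remains
  depends on \<open>z\<close> only through a factor tending to 1 and the upper end of the
  interval.\<close>

lemma kummerM_scaled_Euler_integral:
  fixes a q z :: real
  assumes "a > 0" "q > 0" "z > 0"
  shows "Beta a q * (z powr a * kummerM a (a + q) (- z)) =
    (\<integral>s. indicator {0..z} s * (s powr (a - 1) / exp s * (1 - s / z) powr (q - 1)) \<partial>lborel)"
proof -
  define F where "F t = indicator {0..1} t * (exp (- z * t) * (t powr (a - 1) * (1 - t) powr (q - 1)))"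
    for t :: real
  have "(\<integral>t. F t \<partial>lborel) = (1 / z) * (\<integral>s. F (s / z) \<partial>lborel)"
    using lborel_integral_real_affine[of "1 / z" F 0] assms by simp
  also have "z powr a * \<dots> = (\<integral>s. z powr (a - 1) * F (s / z) \<partial>lborel)"
    using assms powr_diff[of z a 1] by simp
  also have "(\<lambda>s. z powr (a - 1) * F (s / z)) =
     (\<lambda>s. indicator {0..z} s * (s powr (a - 1) / exp s * (1 - s / z) powr (q - 1)))"
  proof
    fix s
    show "z powr (a - 1) * F (s / z) =
      indicator {0..z} s * (s powr (a - 1) / exp s * (1 - s / z) powr (q - 1))"
    proof (cases "s \<in> {0..z}")
      case True
      then have "(s / z) powr (a - 1) = s powr (a - 1) / z powr (a - 1)"
        using assms by (simp add: powr_divide)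
      moreover have "s / z \<in> {0..1}" "exp (- z * (s / z)) = 1 / exp s"
        using True assms by (auto simp: exp_minus field_simps)
      ultimately show ?thesis using True assms by (simp add: F_def)
    next
      case False
      then have "s / z \<notin> {0..1}" using assms by (simp add: divide_le_eq zero_le_divide_iff)
      then show ?thesis using False by (simp add: F_def)
    qed
  qed
  finally have "z powr a * (Beta a q * kummerM a (a + q) (- z)) =
    (\<integral>s. indicator {0..z} s * (s powr (a - 1) / exp s * (1 - s / z) powr (q - 1)) \<partial>lborel)"
    unfolding kummerM_Euler_integral[OF assms(1,2)] F_def .
  then show ?thesis by (simp only: mult.left_commute)
qed

lemma has_bochner_integral_Gamma:
  fixes a :: real
  assumes "a > 0"
  shows "has_bochner_integral lborel (\<lambda>s. indicator {0..} s * (s powr (a - 1) / exp s)) (Gamma a)"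
proof (rule has_bochner_integral_nn_integral)
  show "(\<integral>\<^sup>+ s. ennreal (indicator {0..} s * (s powr (a - 1) / exp s)) \<partial>lborel) = ennreal (Gamma a)"
    using Gamma_conv_nn_integral_real[OF assms] by simp
qed (use assms Gamma_real_pos[of a] in auto)

text \<open>For b > a + 1 the exponent q - 1 is positive, so (1 - s/z) powr (q - 1) is at most 1 and
  the Gamma integrand dominates. The limit is Gamma a / Beta a q.\<close>

lemma kummerM_asymptotics:
  fixes a b :: real
  assumes "a > 0" "b > a + 1"
  shows "((\<lambda>z. z powr a * kummerM a b (- z)) \<longlongrightarrow> Gamma b / Gamma (b - a)) at_top"
proof -
  define q where "q = b - a"
  have q: "q > 1" "b = a + q" using assms by (auto simp: q_def)
  have Gp: "Gamma a > 0" "Gamma q > 0" "Gamma (a + q) > 0"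
    using assms q by (auto intro!: Gamma_real_pos)
  then have Bp: "Beta a q > 0" by (simp add: Beta_def)
  define I where "I z s = indicator {0..z} s * (s powr (a - 1) / exp s * (1 - s / z) powr (q - 1))"
    for z s :: real
  have "((\<lambda>z. integral\<^sup>L lborel (I z)) \<longlongrightarrow>
      (\<integral>s. indicator {0..} s * (s powr (a - 1) / exp s) \<partial>lborel)) at_top"
  proof (rule integral_dominated_convergence_at_top)
    show "integrable lborel (\<lambda>s. indicator {0..} s * (s powr (a - 1) / exp s))"
      using has_bochner_integral_Gamma[OF assms(1)] by (rule integrable.intros)
    show "\<forall>\<^sub>F z in at_top. AE s in lborel. norm (I z s) \<le> indicator {0..} s * (s powr (a - 1) / exp s)"
    proof (intro eventually_mono[OF eventually_gt_at_top[of 0]] AE_I2)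
      fix z s :: real assume "z > 0"
      have "(1 - s / z) powr (q - 1) \<le> 1" if "s \<in> {0..z}"
        using that q \<open>z > 0\<close> by (intro powr_le1) (auto simp: field_simps)
      then show "norm (I z s) \<le> indicator {0..} s * (s powr (a - 1) / exp s)"
        by (auto simp: I_def indicator_def divide_right_mono mult_left_le)
    qed
    show "AE s in lborel. ((\<lambda>z. I z s) \<longlongrightarrow> indicator {0..} s * (s powr (a - 1) / exp s)) at_top"
    proof (rule AE_I2)
      fix s :: real
      have "((\<lambda>z. s powr (a - 1) / exp s * (1 - s / z) powr (q - 1)) \<longlongrightarrow>
          s powr (a - 1) / exp s * (1 - 0) powr (q - 1)) at_top"
        by (intro tendsto_intros real_tendsto_divide_at_top[OF tendsto_const]) (auto simp: filterlim_ident)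
      moreover have "\<forall>\<^sub>F z in at_top. indicator {0..} s * (s powr (a - 1) / exp s * (1 - s / z) powr (q - 1)) = I z s"
        using eventually_ge_at_top[of s] by eventually_elim (auto simp: I_def indicator_def)
      ultimately show "((\<lambda>z. I z s) \<longlongrightarrow> indicator {0..} s * (s powr (a - 1) / exp s)) at_top"
        by (intro Lim_transform_eventually[OF tendsto_mult[OF tendsto_const]]) auto
    qed
  qed (auto simp: I_def[abs_def])
  then have L: "((\<lambda>z. integral\<^sup>L lborel (I z) / Beta a q) \<longlongrightarrow> Gamma a / Beta a q) at_top"
    unfolding has_bochner_integral_integral_eq[OF has_bochner_integral_Gamma[OF assms(1)]]
    using Bp by (intro tendsto_divide tendsto_const) auto
  have ev: "\<forall>\<^sub>F z in at_top. integral\<^sup>L lborel (I z) / Beta a q = z powr a * kummerM a b (- z)"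
  proof (intro eventually_mono[OF eventually_gt_at_top[of 0]])
    fix z :: real assume "z > 0"
    show "integral\<^sup>L lborel (I z) / Beta a q = z powr a * kummerM a b (- z)"
      using kummerM_scaled_Euler_integral[of a q z] assms q \<open>z > 0\<close> Bp
      by (simp add: I_def[abs_def] divide_eq_eq mult_ac)
  qed
  have "Gamma a / Beta a q = Gamma b / Gamma (b - a)"
    using Gp q by (simp add: Beta_def)
  with Lim_transform_eventually[OF L ev] show ?thesis by simp
qed

lemma continuous_bounded_of_tendsto_at_top:
  fixes g :: "real \<Rightarrow> real"
  assumes "continuous_on {0..} g" "(g \<longlongrightarrow> L) at_top"
  shows "\<exists>C. \<forall>z\<ge>0. \<bar>g z\<bar> \<le> C"
proof -
  have "\<forall>\<^sub>F z in at_top. dist (g z) L < 1" using assms(2) by (rule tendstoD) simp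
  then obtain N where N: "\<And>z. z \<ge> N \<Longrightarrow> dist (g z) L < 1"
    by (auto simp: eventually_at_top_linorder)
  have "compact (g ` {0..N})"
    by (intro compact_continuous_image continuous_on_subset[OF assms(1)]) auto
  then obtain B where B: "\<And>z. z \<in> {0..N} \<Longrightarrow> \<bar>g z\<bar> \<le> B"
    using compact_imp_bounded[of "g ` {0..N}"] unfolding bounded_iff by fastforce
  have "\<bar>g z\<bar> \<le> max B (\<bar>L\<bar> + 1)" if "z \<ge> 0" for z
    using B[of z] N[of z] that by (cases "z \<le> N") (auto simp: dist_real_def)
  then show ?thesis by blast
qed

text \<open>The contiguity relation raises \<open>b - a\<close> by one in both summands, so the bound descends from
  the range \<open>b > a + 1\<close> of the Euler integral.\<close>

lemma kummerM_scaled_bounded: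
  fixes a b :: real
  assumes "a > 0" "b > 0"
  shows "\<exists>C. \<forall>z>0. \<bar>z powr a * kummerM a b (- z)\<bar> \<le> C"
proof -
  \<comment> \<open>\<open>m\<close> counts how many uses of the contiguity relation separate b - a
    from the range of the Euler integral. Both parameters change along the way, so the induction
    generalises over them.\<close>
  have "\<exists>C. \<forall>z>0. \<bar>z powr a * kummerM a b (- z)\<bar> \<le> C" if "a > 0" "b > 0" "b - a + real m > 1" for m and a b :: real
    using that
  proof (induction m arbitrary: a b)
    case 0
    have "isCont (\<lambda>z. kummerM a b (- z)) z" for z
      by (rule isCont_o2[where g = "kummerM a b"]) (use kummerM_continuous[OF 0(1,2)] in auto)
    then have "continuous_on {0..} (\<lambda>z. z powr a * kummerM a b (- z))"
      using 0 by (intro continuous_on_mult continuous_on_powr' continuous_intros) (auto intro: continuous_at_imp_continuous_on)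
    from continuous_bounded_of_tendsto_at_top[OF this kummerM_asymptotics] 0
    obtain C where "\<forall>z\<ge>0. \<bar>z powr a * kummerM a b (- z)\<bar> \<le> C" by auto
    then show ?case by (intro exI[of _ C]) auto
  next
    case (Suc m)
    obtain C1 where C1: "\<And>z. z > 0 \<Longrightarrow> \<bar>z powr a * kummerM a (b + 1) (- z)\<bar> \<le> C1"
      using Suc.IH[of a "b + 1"] Suc.prems by auto
    obtain C2 where C2: "\<And>z. z > 0 \<Longrightarrow> \<bar>z powr (a + 1) * kummerM (a + 1) (b + 2) (- z)\<bar> \<le> C2"
      using Suc.IH[of "a + 1" "b + 2"] Suc.prems by auto
    have "\<bar>z powr a * kummerM a b (- z)\<bar> \<le> C1 + a / (b * (b + 1)) * C2" if z: "z > 0" for z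
    proof -
      have "z powr a * kummerM a b (- z) = z powr a * kummerM a (b + 1) (- z)
          - a / (b * (b + 1)) * (z powr (a + 1) * kummerM (a + 1) (b + 2) (- z))"
        using Suc.prems(1,2) z by (subst kummerM_contiguous_b[of a b "- z"]) (auto simp: powr_add right_diff_distrib)
      also have "\<bar>\<dots>\<bar> \<le> \<bar>z powr a * kummerM a (b + 1) (- z)\<bar>
          + \<bar>a / (b * (b + 1)) * (z powr (a + 1) * kummerM (a + 1) (b + 2) (- z))\<bar>"
        by (rule abs_triangle_ineq4)
      also have "\<bar>a / (b * (b + 1)) * (z powr (a + 1) * kummerM (a + 1) (b + 2) (- z))\<bar>
          = a / (b * (b + 1)) * \<bar>z powr (a + 1) * kummerM (a + 1) (b + 2) (- z)\<bar>"
        using Suc.prems by (simp add: abs_mult)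
      also have "\<bar>z powr a * kummerM a (b + 1) (- z)\<bar> + \<dots> \<le> C1 + a / (b * (b + 1)) * C2"
        using Suc.prems z by (intro add_mono mult_left_mono C1 C2) auto
      finally show ?thesis .
    qed
    then show ?case by blast
  qed
  moreover obtain m :: nat where "real m > 1 - (b - a)" using reals_Archimedean2 by blast
  ultimately show ?thesis using assms by (metis add.commute diff_less_eq)
qed

text \<open>Serves the weighted derivatives, where the first parameter has risen while the power of
  z is still \<open>k\<close>. Up to z = 1 continuity of M suffices; beyond it
  \<open>z powr k\<close> is dominated by \<open>z powr a\<close>.\<close>

lemma kummerM_scaled_bounded_mono:
  fixes a b k :: real
  assumes "a > 0" "b > 0" "0 < k" "k \<le> a"
  shows "\<exists>C. \<forall>z>0. \<bar>z powr k * kummerM a b (- z)\<bar> \<le> C"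
proof -
  obtain C where C: "\<And>z. z > 0 \<Longrightarrow> \<bar>z powr a * kummerM a b (- z)\<bar> \<le> C"
    using kummerM_scaled_bounded[OF assms(1,2)] by auto
  have "isCont (\<lambda>z. kummerM a b (- z)) z" for z
    by (rule isCont_o2[where g = "kummerM a b"]) (use kummerM_continuous[OF assms(1,2)] in auto)
  then have "compact ((\<lambda>z. kummerM a b (- z)) ` {0..1})"
    by (intro compact_continuous_image) (auto intro: continuous_at_imp_continuous_on)
  then obtain B where B: "\<And>z. z \<in> {0..1} \<Longrightarrow> \<bar>kummerM a b (- z)\<bar> \<le> B"
    using compact_imp_bounded[of "(\<lambda>z. kummerM a b (- z)) ` {0..1}"] unfolding bounded_iff by fastforce
  have "\<bar>z powr k * kummerM a b (- z)\<bar> \<le> max B C" if z: "z > 0" for z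
  proof (cases "z \<le> 1")
    case True
    have "z powr k \<le> 1" using True z assms by (intro powr_le1) auto
    then have "\<bar>z powr k * kummerM a b (- z)\<bar> \<le> 1 * B"
      unfolding abs_mult using B[of z] True z by (intro mult_mono) auto
    then show ?thesis by simp
  next
    case False
    then have "z powr k \<le> z powr a" using assms by (intro powr_mono) auto
    then have "\<bar>z powr k * kummerM a b (- z)\<bar> \<le> \<bar>z powr a * kummerM a b (- z)\<bar>"
      unfolding abs_mult by (intro mult_right_mono) auto
    with C[OF z] show ?thesis by simp
  qed
  then show ?thesis by blast
qed

section \<open>The candidate solution, its derivatives and its boundary values\<close>

text \<open>For \<open>\<alpha> = \<sigma>\<^sup>2 / 2\<close> this is \<open>z powr a * M(a, c, -z)\<close> at \<open>z = 2 / (x \<sigma>\<^sup>2)\<close>: differentiation in \<open>x\<close>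
  merely shifts \<open>a\<close> to \<open>a + 1\<close>, so all derivatives are bounded on the half-line.\<close>

definition kummerG :: "real \<Rightarrow> real \<Rightarrow> real \<Rightarrow> real \<Rightarrow> real" where
  "kummerG \<alpha> c a x = (1 / (\<alpha> * x)) powr a * kummerM a c (- (1 / (\<alpha> * x)))"

text \<open>In d/dz (z powr a * M(a, c, -z)) the derivative of the power cancels the unshifted term
  of \<open>kummerM_has_derivative\<close>. Then dz/dx = - \<alpha> z^2 restores the exponent to a +
  1.\<close>

lemma kummerG_has_derivative:
  assumes "\<alpha> > 0" "c > 0" "a > 0" "x > 0"
  shows "(kummerG \<alpha> c a has_real_derivative - \<alpha> * a * kummerG \<alpha> c (a + 1) x) (at x)"
proof -
  define z where "z = 1 / (\<alpha> * x)"
  have z: "z > 0" using assms by (simp add: z_def)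
  have dz: "((\<lambda>x. 1 / (\<alpha> * x)) has_real_derivative - \<alpha> * z\<^sup>2) (at x)"
    using assms unfolding z_def
    by (auto intro!: derivative_eq_intros simp: power2_eq_square field_simps)
  have d1: "((\<lambda>z. kummerM a c (- z)) has_real_derivative
      a * (kummerM (a + 1) c (- z) - kummerM a c (- z)) / (- z) * (- 1)) (at z)"
    using z assms by (intro DERIV_chain2[OF kummerM_has_derivative]) (auto intro!: derivative_eq_intros)
  have d2: "((\<lambda>z. z powr a) has_real_derivative a * z powr (a - 1)) (at z)"
    using z by (auto intro!: derivative_eq_intros)
  have "((\<lambda>z. z powr a * kummerM a c (- z)) has_real_derivative
      a * z powr (a - 1) * kummerM a c (- z)
      + z powr a * (a * (kummerM (a + 1) c (- z) - kummerM a c (- z)) / (- z) * (- 1))) (at z)"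
    by (rule DERIV_cong[OF DERIV_mult[OF d2 d1]]) (simp add: mult_ac)
  also have "a * z powr (a - 1) * kummerM a c (- z)
      + z powr a * (a * (kummerM (a + 1) c (- z) - kummerM a c (- z)) / (- z) * (- 1))
      = a * z powr (a - 1) * kummerM (a + 1) c (- z)"
    using z by (simp add: powr_diff right_diff_distrib diff_divide_distrib)
  finally have "((\<lambda>z. z powr a * kummerM a c (- z)) has_real_derivative
      a * z powr (a - 1) * kummerM (a + 1) c (- z)) (at (1 / (\<alpha> * x)))" unfolding z_def .
  from DERIV_chain2[OF this dz]
  have "(kummerG \<alpha> c a has_real_derivative
      a * z powr (a - 1) * kummerM (a + 1) c (- z) * (- \<alpha> * z\<^sup>2)) (at x)"
    by (simp add: kummerG_def[abs_def])
  moreover have e: "z powr (a + 1) = z powr (a - 1) * z\<^sup>2"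
    using z powr_add[of z "a - 1" 2] by (simp add: add.commute)
  have "a * z powr (a - 1) * kummerM (a + 1) c (- z) * (- \<alpha> * z\<^sup>2)
      = - \<alpha> * a * (z powr (a + 1) * kummerM (a + 1) c (- z))"
    unfolding e by (simp add: mult_ac)
  ultimately show ?thesis by (simp only: kummerG_def z_def[symmetric])
qed

lemma kummerG_bounded:
  assumes "\<alpha> > 0" "c > 0" "a > 0"
  shows "\<exists>B. \<forall>x>0. \<bar>kummerG \<alpha> c a x\<bar> \<le> B"
proof -
  obtain B where B: "\<forall>z>0. \<bar>z powr a * kummerM a c (- z)\<bar> \<le> B"
    using kummerM_scaled_bounded[OF assms(3,2)] by blast
  show ?thesis using B assms by (intro exI[of _ B]) (simp add: kummerG_def)
qed

text \<open>Since x = 1 / (\<alpha> z), the weight \<open>x ^ j\<close> removes exactly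
  \<open>j\<close> powers of z and leaves exponent \<open>k\<close> at first parameter k +
  j.\<close>

lemma kummerG_power_bounded:
  assumes "\<alpha> > 0" "c > 0" "k > 0"
  shows "\<exists>B. \<forall>x>0. \<bar>x ^ j * kummerG \<alpha> c (k + real j) x\<bar> \<le> B"
proof -
  obtain B where B: "\<And>z. z > 0 \<Longrightarrow> \<bar>z powr k * kummerM (k + real j) c (- z)\<bar> \<le> B"
    using kummerM_scaled_bounded_mono[of "k + real j" c k] assms by auto
  have "\<bar>x ^ j * kummerG \<alpha> c (k + real j) x\<bar> \<le> B / \<alpha> ^ j" if x: "x > 0" for x
  proof -
    define z where "z = 1 / (\<alpha> * x)"
    have z: "z > 0" using assms x by (simp add: z_def)
    have "x = 1 / (\<alpha> * z)" using assms x by (simp add: z_def)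
    then have "x ^ j * kummerG \<alpha> c (k + real j) x
        = z powr k * kummerM (k + real j) c (- z) / \<alpha> ^ j"
      using z assms
      by (simp add: kummerG_def z_def[symmetric] powr_add powr_realpow power_divide power_mult_distrib)
    then show ?thesis using B[OF z] assms by (simp add: divide_right_mono)
  qed
  then show ?thesis by blast
qed

text \<open>With derivatives written as shifts of \<open>a\<close>, this is
  \<open>kummerM_contiguous_a\<close> at -z times \<alpha> a z powr a. The relation between
  \<open>c\<close> and \<open>a\<close> is what makes (\<mu> + \<alpha>) x z equal to the
  coefficient 2a + 2 - c there.\<close>

lemma kummerG_ode:
  assumes "\<alpha> > 0" "c > 0" "a > 0" "x > 0" and c: "c = 1 - \<mu> / \<alpha> + 2 * a"
  shows "\<alpha> * x\<^sup>2 * (\<alpha>\<^sup>2 * a * (a + 1) * kummerG \<alpha> c (a + 2) x)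
    + ((\<mu> + \<alpha>) * x - 1) * (- \<alpha> * a * kummerG \<alpha> c (a + 1) x)
    = (\<alpha> * a\<^sup>2 - \<mu> * a) * kummerG \<alpha> c a x"
proof -
  define z where "z = 1 / (\<alpha> * x)"
  have z: "z > 0" using assms by (simp add: z_def)
  have x: "x = 1 / (\<alpha> * z)" using assms by (simp add: z_def)
  have \<mu>: "\<mu> = \<alpha> * (1 + 2 * a - c)" using assms by (simp add: field_simps)
  have K: "(c - a - 1) * kummerM a c (- z) + (2 * a + 2 - c - z) * kummerM (a + 1) c (- z)
           = (a + 1) * kummerM (a + 2) c (- z)"
    using kummerM_contiguous_a[of a c "- z"] assms by simp
  have p: "z powr (a + 1) = z powr a * z" "z powr (a + 2) = z powr a * z\<^sup>2"
    using z by (auto simp: powr_add)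
  have "\<alpha> * x\<^sup>2 * (\<alpha>\<^sup>2 * a * (a + 1) * kummerG \<alpha> c (a + 2) x)
      = \<alpha> * a * z powr a * ((a + 1) * kummerM (a + 2) c (- z))"
    unfolding kummerG_def z_def[symmetric] p unfolding x
    using assms z by (simp add: power2_eq_square field_simps)
  moreover have "((\<mu> + \<alpha>) * x - 1) * (- \<alpha> * a * kummerG \<alpha> c (a + 1) x)
      = - \<alpha> * a * z powr a * ((2 * a + 2 - c - z) * kummerM (a + 1) c (- z))"
  proof -
    have "(\<mu> + \<alpha>) * x * z = 2 * a + 2 - c" unfolding x \<mu> using assms z by (simp add: field_simps)
    then have "((\<mu> + \<alpha>) * x - 1) * z = 2 * a + 2 - c - z" by (simp add: left_diff_distrib)
    then show ?thesis unfolding kummerG_def z_def[symmetric] p by (simp add: mult_ac)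
  qed
  moreover have "(\<alpha> * a\<^sup>2 - \<mu> * a) * kummerG \<alpha> c a x
      = \<alpha> * a * z powr a * ((c - a - 1) * kummerM a c (- z))"
    unfolding kummerG_def z_def[symmetric] \<mu> by (simp add: power2_eq_square algebra_simps)
  ultimately show ?thesis unfolding K[symmetric] by (simp add: algebra_simps)
qed

lemma kummerG_at_right_0:
  assumes "\<alpha> > 0" "a > 0" "c > a + 1"
  shows "(kummerG \<alpha> c a \<longlongrightarrow> Gamma c / Gamma (c - a)) (at_right 0)"
proof -
  have "filterlim (\<lambda>x. 1 / (\<alpha> * x)) at_top (at_right 0)"
    using assms(1) by real_asymp
  from filterlim_compose[OF kummerM_asymptotics[OF assms(2,3)] this]
  show ?thesis by (simp add: kummerG_def[abs_def])
qed

lemma kummerG_at_top: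
  assumes "\<alpha> > 0" "a > 0" "c > 0"
  shows "(kummerG \<alpha> c a \<longlongrightarrow> 0) at_top"
proof -
  have 1: "((\<lambda>x. (1 / (\<alpha> * x)) powr a) \<longlongrightarrow> 0) at_top"
    using assms by real_asymp
  have "((\<lambda>x. - (1 / (\<alpha> * x))) \<longlongrightarrow> 0) at_top"
    using assms by real_asymp
  then have "((\<lambda>x. kummerM a c (- (1 / (\<alpha> * x)))) \<longlongrightarrow> kummerM a c 0) at_top"
    by (rule isCont_tendsto_compose[OF kummerM_continuous[OF assms(2,3)]])
  from tendsto_mult[OF 1 this] show ?thesis by (simp add: kummerG_def[abs_def])
qed

section \<open>One-step error of the time discretisation\<close>

text \<open>The quadratic part is evaluated exactly by the moments of N(0, h), whose odd ones
  vanish. The remainder is the third absolute moment of \<mu> h + \<sigma> N: the cube of the sum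
  costs a factor 4, h^3 is at most h powr (3/2), and E \<bar>N\<bar>^3 = 2 sqrt (2/pi) h powr (3/2)
  is at most 2 h powr (3/2), whence 4 and 8 in the constant.\<close>

lemma gauss_moment_expansion:
  fixes \<mu> \<sigma> h c0 c1 c2 B :: real and \<phi> :: "real \<Rightarrow> real"
  assumes h: "0 < h" "h \<le> 1" and "\<sigma> > 0" "B \<ge> 0"
    and [measurable]: "\<phi> \<in> borel_measurable borel"
    and taylor: "\<And>s. \<bar>\<phi> s - (c0 + c1 * s + c2 * s\<^sup>2)\<bar> \<le> B * \<bar>s\<bar> ^ 3"
  shows "\<bar>(\<integral>n. normal_density 0 (sqrt h) n * \<phi> (\<mu> * h + \<sigma> * n) \<partial>lborel)
      - (c0 + c1 * (\<mu> * h) + c2 * (\<mu>\<^sup>2 * h\<^sup>2 + \<sigma>\<^sup>2 * h))\<bar> \<le> B * (4 * \<bar>\<mu>\<bar> ^ 3 + 8 * \<sigma> ^ 3) * (h * sqrt h)"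
proof -
  let ?d = "normal_density 0 (sqrt h)"
  let ?s = "\<lambda>n. \<mu> * h + \<sigma> * n"
  let ?q = "\<lambda>s. c0 + c1 * s + c2 * s\<^sup>2"
  have sh: "sqrt h > 0" using h by simp
  have m0: "has_bochner_integral lborel ?d 1"
    using normal_moment_even[OF sh, of 0 0] by simp
  have m1: "has_bochner_integral lborel (\<lambda>n. ?d n * n) 0"
    using normal_moment_odd[OF sh, of 0 0] by simp
  have m2: "has_bochner_integral lborel (\<lambda>n. ?d n * n\<^sup>2) h"
    using normal_moment_even[OF sh, of 0 1] h by simp
  define m where "m = 2 * sqrt h ^ 3 * sqrt (2 / pi)"
  have m3: "has_bochner_integral lborel (\<lambda>n. ?d n * \<bar>n\<bar> ^ 3) m"
    using normal_moment_abs_odd[OF sh, of 0 1] by (simp add: m_def eval_nat_numeral)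
  have q: "has_bochner_integral lborel (\<lambda>n. ?d n * ?q (?s n))
      (c0 + c1 * (\<mu> * h) + c2 * (\<mu>\<^sup>2 * h\<^sup>2 + \<sigma>\<^sup>2 * h))"
  proof -
    have "has_bochner_integral lborel (\<lambda>n. (c0 + c1 * (\<mu> * h) + c2 * (\<mu> * h)\<^sup>2) * ?d n
        + (c1 * \<sigma> + 2 * c2 * \<mu> * h * \<sigma>) * (?d n * n) + c2 * \<sigma>\<^sup>2 * (?d n * n\<^sup>2))
        ((c0 + c1 * (\<mu> * h) + c2 * (\<mu> * h)\<^sup>2) * 1 + (c1 * \<sigma> + 2 * c2 * \<mu> * h * \<sigma>) * 0 + c2 * \<sigma>\<^sup>2 * h)"
      by (intro has_bochner_integral_add has_bochner_integral_mult_right m0 m1 m2)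
    then show ?thesis
      by (rule has_bochner_integral_cong[THEN iffD1, rotated -1])
        (auto simp: algebra_simps power2_eq_square)
  qed
  have cube: "\<bar>?s n\<bar> ^ 3 \<le> 4 * \<bar>\<mu>\<bar> ^ 3 * h ^ 3 + 4 * \<sigma> ^ 3 * \<bar>n\<bar> ^ 3" for n
  proof -
    \<comment> \<open>Convexity of the cube, with the defect 3 (u + v) (u - v)^2 written
      out.\<close>
    have conv: "(u + v) ^ 3 \<le> 4 * u ^ 3 + 4 * v ^ 3" if "u \<ge> 0" "v \<ge> 0" for u v :: real
    proof -
      have "4 * u ^ 3 + 4 * v ^ 3 - (u + v) ^ 3 = 3 * (u + v) * (u - v)\<^sup>2"
        by (simp add: power3_eq_cube power2_eq_square algebra_simps)
      moreover have "\<dots> \<ge> 0" using that by simp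
      ultimately show ?thesis by linarith
    qed
    have "\<bar>?s n\<bar> \<le> \<bar>\<mu>\<bar> * h + \<sigma> * \<bar>n\<bar>"
      using abs_triangle_ineq[of "\<mu> * h" "\<sigma> * n"] h \<open>\<sigma> > 0\<close> by (simp add: abs_mult)
    then have "\<bar>?s n\<bar> ^ 3 \<le> (\<bar>\<mu>\<bar> * h + \<sigma> * \<bar>n\<bar>) ^ 3" by (rule power_mono) simp
    also have "\<dots> \<le> 4 * (\<bar>\<mu>\<bar> * h) ^ 3 + 4 * (\<sigma> * \<bar>n\<bar>) ^ 3"
      using h \<open>\<sigma> > 0\<close> by (intro conv) auto
    finally show ?thesis by (simp add: power_mult_distrib)
  qed
  have bnd: "has_bochner_integral lborel
      (\<lambda>n. B * (4 * \<bar>\<mu>\<bar> ^ 3 * h ^ 3) * ?d n + B * (4 * \<sigma> ^ 3) * (?d n * \<bar>n\<bar> ^ 3))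
      (B * (4 * \<bar>\<mu>\<bar> ^ 3 * h ^ 3) * 1 + B * (4 * \<sigma> ^ 3) * m)"
    by (intro has_bochner_integral_add has_bochner_integral_mult_right m0 m3)
  have le: "\<bar>?d n * (\<phi> (?s n) - ?q (?s n))\<bar>
      \<le> B * (4 * \<bar>\<mu>\<bar> ^ 3 * h ^ 3) * ?d n + B * (4 * \<sigma> ^ 3) * (?d n * \<bar>n\<bar> ^ 3)" for n
  proof -
    have "\<bar>?d n * (\<phi> (?s n) - ?q (?s n))\<bar> \<le> ?d n * (B * \<bar>?s n\<bar> ^ 3)"
      unfolding abs_mult using taylor[of "?s n"] by (simp add: mult_left_mono)
    also have "\<dots> \<le> ?d n * (B * (4 * \<bar>\<mu>\<bar> ^ 3 * h ^ 3 + 4 * \<sigma> ^ 3 * \<bar>n\<bar> ^ 3))"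
      using cube[of n] \<open>B \<ge> 0\<close> by (intro mult_left_mono) auto
    finally show ?thesis by (simp add: algebra_simps)
  qed
  have int: "integrable lborel (\<lambda>n. ?d n * (\<phi> (?s n) - ?q (?s n)))"
    by (rule Bochner_Integration.integrable_bound[OF integrable.intros[OF bnd]])
      (use le in \<open>auto intro!: AE_I2 intro: order_trans[OF _ abs_ge_self]\<close>)
  have "(\<integral>n. ?d n * \<phi> (?s n) \<partial>lborel)
      = (\<integral>n. ?d n * (\<phi> (?s n) - ?q (?s n)) + ?d n * ?q (?s n) \<partial>lborel)"
    by (simp add: algebra_simps)
  also have "\<dots> = (\<integral>n. ?d n * (\<phi> (?s n) - ?q (?s n)) \<partial>lborel)
      + (c0 + c1 * (\<mu> * h) + c2 * (\<mu>\<^sup>2 * h\<^sup>2 + \<sigma>\<^sup>2 * h))"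
    using Bochner_Integration.integral_add[OF int integrable.intros[OF q]]
      has_bochner_integral_integral_eq[OF q] by simp
  finally have "\<bar>(\<integral>n. ?d n * \<phi> (?s n) \<partial>lborel)
      - (c0 + c1 * (\<mu> * h) + c2 * (\<mu>\<^sup>2 * h\<^sup>2 + \<sigma>\<^sup>2 * h))\<bar>
      = \<bar>\<integral>n. ?d n * (\<phi> (?s n) - ?q (?s n)) \<partial>lborel\<bar>" by simp
  also have "\<dots> \<le> (\<integral>n. B * (4 * \<bar>\<mu>\<bar> ^ 3 * h ^ 3) * ?d n + B * (4 * \<sigma> ^ 3) * (?d n * \<bar>n\<bar> ^ 3) \<partial>lborel)"
    using le by (intro integral_abs_bound_integral[OF int integrable.intros[OF bnd]]) auto
  also have "\<dots> = B * (4 * \<bar>\<mu>\<bar> ^ 3 * h ^ 3) * 1 + B * (4 * \<sigma> ^ 3) * m"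
    by (rule has_bochner_integral_integral_eq[OF bnd])
  also have "\<dots> \<le> B * (4 * \<bar>\<mu>\<bar> ^ 3 * (h * sqrt h)) * 1 + B * (4 * \<sigma> ^ 3) * (2 * (h * sqrt h))"
  proof (intro add_mono mult_left_mono mult_right_mono)
    have hs: "h \<le> sqrt h" using h by (intro real_le_rsqrt) (simp add: power2_eq_square mult_left_le)
    have "h ^ 3 = h * (h * h)" by (simp add: power3_eq_cube)
    also have "\<dots> \<le> h * (1 * sqrt h)" using h hs by (intro mult_left_mono mult_mono) auto
    finally show "h ^ 3 \<le> h * sqrt h" by simp
    have "sqrt (2 / pi) \<le> 1" using pi_ge_two by simp
    moreover have "sqrt h ^ 3 = h * sqrt h" using h by (simp add: power3_eq_cube)
    ultimately show "m \<le> 2 * (h * sqrt h)" unfolding m_def using h by (simp add: mult_left_le)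
  qed (use \<open>B \<ge> 0\<close> \<open>\<sigma> > 0\<close> in auto)
  also have "\<dots> = B * (4 * \<bar>\<mu>\<bar> ^ 3 + 8 * \<sigma> ^ 3) * (h * sqrt h)" by (simp add: algebra_simps)
  finally show ?thesis .
qed

text \<open>All that the probabilistic argument uses of the Kummer solution. The weighted bounds are
  invariant under scaling of x and control the multiplicative noise; the unweighted ones control the
  shift by \<open>h\<close>. The third derivative enters only with its weight.\<close>

locale resolvent_solution =
  fixes f f1 f2 f3 :: "real \<Rightarrow> real" and \<mu> \<sigma> lam B :: real
  assumes \<sigma>: "\<sigma> > 0" and lam: "lam > 0"
    and d1: "\<And>x. x > 0 \<Longrightarrow> (f has_real_derivative f1 x) (at x)"
    and d2: "\<And>x. x > 0 \<Longrightarrow> (f1 has_real_derivative f2 x) (at x)"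
    and d3: "\<And>x. x > 0 \<Longrightarrow> (f2 has_real_derivative f3 x) (at x)"
    and bound: "\<And>x. x > 0 \<Longrightarrow> \<bar>f x\<bar> \<le> B" "\<And>x. x > 0 \<Longrightarrow> \<bar>f1 x\<bar> \<le> B" "\<And>x. x > 0 \<Longrightarrow> \<bar>f2 x\<bar> \<le> B"
    and weighted_bound: "\<And>x. x > 0 \<Longrightarrow> \<bar>x * f1 x\<bar> \<le> B" "\<And>x. x > 0 \<Longrightarrow> \<bar>x\<^sup>2 * f2 x\<bar> \<le> B"
      "\<And>x. x > 0 \<Longrightarrow> \<bar>x ^ 3 * f3 x\<bar> \<le> B"
    and ode: "\<And>x. x > 0 \<Longrightarrow>
      1/2 * \<sigma>\<^sup>2 * x\<^sup>2 * f2 x + ((\<mu> + \<sigma>\<^sup>2 / 2) * x - 1) * f1 x - lam * f x = 0"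
    and at_0: "(f \<longlongrightarrow> 1) (at_right 0)"
begin

lemma B_nonneg: "B \<ge> 0" using bound(1)[of 1] by simp

definition F :: "real \<Rightarrow> real" where "F x = (if x \<le> 0 then 1 else f x)"

lemma F_nonpos [simp]: "x \<le> 0 \<Longrightarrow> F x = 1" and F_pos: "x > 0 \<Longrightarrow> F x = f x"
  by (auto simp: F_def)

lemma F_measurable [measurable]: "F \<in> borel_measurable borel"
proof -
  have "f \<in> borel_measurable (restrict_space borel {0<..})"
    by (intro borel_measurable_continuous_on_restrict continuous_at_imp_continuous_on ballI)
      (use d1 DERIV_isCont in auto)
  then have "(\<lambda>x. if x \<in> {0<..} then f x else 1) \<in> borel_measurable borel"
    by (subst measurable_If_restrict_space_iff) (auto simp: greaterThan_def)
  also have "(\<lambda>x. if x \<in> {0<..} then f x else 1) = F" by (auto simp: F_def)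
  finally show ?thesis .
qed

lemma F_bound: "\<bar>F x\<bar> \<le> B + 1"
  using bound(1)[of x] B_nonneg by (auto simp: F_def)

text \<open>Taylor's formula in s = log (x / w). The derivatives are iterates of x d/dx, and they
  are evaluated at an unknown point w exp t, where scale-invariant bounds apply uniformly.\<close>

lemma log_taylor:
  assumes w: "w > 0"
  shows "\<bar>f (w * exp s) - (f w + w * f1 w * s + (w\<^sup>2 * f2 w + w * f1 w) / 2 * s\<^sup>2)\<bar> \<le> B * \<bar>s\<bar> ^ 3"
proof -
  define D where "D m t = (if m = 0 then f (w * exp t)
     else if m = 1 then w * exp t * f1 (w * exp t)
     else if m = 2 then (w * exp t)\<^sup>2 * f2 (w * exp t) + w * exp t * f1 (w * exp t)
     else (w * exp t) ^ 3 * f3 (w * exp t) + 3 * ((w * exp t)\<^sup>2 * f2 (w * exp t)) + w * exp t * f1 (w * exp t))"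
    for m :: nat and t
  have e: "((\<lambda>t. w * exp t) has_real_derivative w * exp t) (at t)" for t
    by (auto intro!: derivative_eq_intros)
  have pos: "w * exp t > 0" for t using w by simp
  have c1: "((\<lambda>t. f (w * exp t)) has_real_derivative f1 (w * exp t) * (w * exp t)) (at t)" for t
    by (rule DERIV_chain2[OF d1[OF pos] e])
  have c2: "((\<lambda>t. f1 (w * exp t)) has_real_derivative f2 (w * exp t) * (w * exp t)) (at t)" for t
    by (rule DERIV_chain2[OF d2[OF pos] e])
  have c3: "((\<lambda>t. f2 (w * exp t)) has_real_derivative f3 (w * exp t) * (w * exp t)) (at t)" for t
    by (rule DERIV_chain2[OF d3[OF pos] e])
  have "\<forall>m t. m < 3 \<and> \<bar>t\<bar> \<le> \<bar>s\<bar> \<longrightarrow> DERIV (D m) t :> D (Suc m) t"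
  proof (intro allI impI)
    fix m :: nat and t :: real assume "m < 3 \<and> \<bar>t\<bar> \<le> \<bar>s\<bar>"
    then consider "m = 0" | "m = 1" | "m = 2" by linarith
    then show "DERIV (D m) t :> D (Suc m) t"
    proof cases
      case 1
      then show ?thesis using c1[of t] by (simp add: D_def[abs_def] mult_ac)
    next
      case 2
      then show ?thesis using DERIV_mult[OF e c2, of t]
        by (simp add: D_def[abs_def] power2_eq_square algebra_simps)
    next
      case 3
      have "((\<lambda>t. (w * exp t)\<^sup>2) has_real_derivative 2 * (w * exp t) * (w * exp t)) (at t)"
        by (rule DERIV_cong[OF DERIV_power[OF e]]) simp
      from DERIV_add[OF DERIV_mult[OF this c3] DERIV_mult[OF e c2]] show ?thesis
        using 3 by (simp add: D_def[abs_def] power2_eq_square power3_eq_cube algebra_simps)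
    qed
  qed
  from Maclaurin_bi_le[of D "\<lambda>t. f (w * exp t)" 3 s, OF _ this]
  obtain t where t: "f (w * exp s) = (\<Sum>m<3. D m 0 / fact m * s ^ m) + D 3 t / fact 3 * s ^ 3"
    by (auto simp: D_def[abs_def])
  have "(\<Sum>m<3. D m 0 / fact m * s ^ m) = f w + w * f1 w * s + (w\<^sup>2 * f2 w + w * f1 w) / 2 * s\<^sup>2"
    by (simp add: eval_nat_numeral D_def)
  then have "\<bar>f (w * exp s) - (f w + w * f1 w * s + (w\<^sup>2 * f2 w + w * f1 w) / 2 * s\<^sup>2)\<bar>
      = \<bar>D 3 t\<bar> / 6 * \<bar>s\<bar> ^ 3"
    unfolding t by (simp add: abs_mult power_abs fact_numeral)
  also have "\<dots> \<le> B * \<bar>s\<bar> ^ 3"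
  proof (rule mult_right_mono)
    \<comment> \<open>The coefficients 1, 3, 1 of the third iterate give 5 B, and 5/6 is below
      1.\<close>
    have "\<bar>D 3 t\<bar> \<le> B + 3 * B + B"
      unfolding D_def using weighted_bound[OF pos[of t]] by (simp add: abs_le_iff)
    then show "\<bar>D 3 t\<bar> / 6 \<le> B" using B_nonneg by simp
  qed simp
  finally show ?thesis .
qed

text \<open>The shift from x - h back to x is additive and may be large relative to w, so here the
  bound on \<open>f2\<close> itself is used.\<close>

lemma forward_taylor:
  assumes "w > 0" "h > 0"
  shows "\<bar>f (w + h) - (f w + h * f1 w)\<bar> \<le> B * h\<^sup>2"
proof -
  define D where "D m t = (if m = 0 then f (w + t) else if m = 1 then f1 (w + t) else f2 (w + t))"
    for m :: nat and t
  have "\<forall>m t. m < 2 \<and> 0 \<le> t \<and> t \<le> h \<longrightarrow> DERIV (D m) t :> D (Suc m) t"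
  proof (intro allI impI)
    fix m :: nat and t :: real assume a: "m < 2 \<and> 0 \<le> t \<and> t \<le> h"
    then have p: "w + t > 0" using assms by simp
    have e: "((\<lambda>t. w + t) has_real_derivative 1) (at t)" by (auto intro!: derivative_eq_intros)
    from a consider "m = 0" | "m = 1" by linarith
    then show "DERIV (D m) t :> D (Suc m) t"
      using DERIV_chain2[OF d1[OF p] e] DERIV_chain2[OF d2[OF p] e] by cases (auto simp: D_def[abs_def])
  qed
  from Maclaurin[of h 2 D "\<lambda>t. f (w + t)", OF _ _ _ this]
  obtain t where t: "0 < t" "t < h" "f (w + h) = (\<Sum>m<2. D m 0 / fact m * h ^ m) + D 2 t / fact 2 * h ^ 2"
    using assms by (auto simp: D_def[abs_def])
  have "f (w + h) - (f w + h * f1 w) = f2 (w + t) / 2 * h\<^sup>2"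
    unfolding t(3) by (simp add: eval_nat_numeral D_def)
  then have "\<bar>f (w + h) - (f w + h * f1 w)\<bar> = \<bar>f2 (w + t)\<bar> / 2 * h\<^sup>2"
    by (simp only: abs_mult abs_divide) simp
  also have "\<dots> \<le> B * h\<^sup>2"
    using bound(3)[of "w + t"] assms t B_nonneg by (intro mult_right_mono) auto
  finally show ?thesis .
qed

text \<open>The transition operator of the budget chain applied to \<open>F\<close>: the conditional
  expectation of \<open>F\<close> after one step from \<open>x\<close>.\<close>

definition T :: "real \<Rightarrow> real \<Rightarrow> real" where
  "T h x = (\<integral>n. normal_density 0 (sqrt h) n * F ((x - h) * exp (\<mu> * h + \<sigma> * n)) \<partial>lborel)"

lemma T_le:
  assumes "h > 0" "x \<le> h"
  shows "T h x = 1"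
proof -
  have "(x - h) * exp (\<mu> * h + \<sigma> * n) \<le> 0" for n
    using assms by (simp add: mult_le_0_iff)
  then show ?thesis unfolding T_def using assms by simp
qed

text \<open>The summands belong, in order, to the Gaussian Taylor remainder, the remainder of the
  shift by \<open>h\<close>, the replacement of \<open>f w\<close> by \<open>f x\<close> in the term
  lam h f, the moment term \<mu>^2 h^2, and the gap between 1 + lam h and exp (lam h).\<close>

definition C :: real where
  "C = B * (4 * \<bar>\<mu>\<bar> ^ 3 + 8 * \<sigma> ^ 3) + B + 2 * lam * B + \<mu>\<^sup>2 * B + lam\<^sup>2 * B"

text \<open>The expansion is made at w = x - h, where the noise acts, and the shift then carries it
  to x. To first order \<open>T h x\<close> is (1 + lam h) f x, which the discount factor
  compensates.\<close>

lemma one_step_error: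
  assumes h: "0 < h" "h \<le> 1" and x: "x > h"
  shows "\<bar>exp (- lam * h) * T h x - f x\<bar> \<le> C * (h * sqrt h)"
proof -
  define w where "w = x - h"
  have w: "w > 0" "x = w + h" using x by (auto simp: w_def)
  let ?H = "h * sqrt h"
  have hs: "h \<le> sqrt h" using h by (intro real_le_rsqrt) (simp add: power2_eq_square mult_left_le)
  then have h2: "h\<^sup>2 \<le> ?H" using h by (simp add: power2_eq_square)
  define R1 where "R1 = T h x - (f w + w * f1 w * (\<mu> * h) + (w\<^sup>2 * f2 w + w * f1 w) / 2 * (\<mu>\<^sup>2 * h\<^sup>2 + \<sigma>\<^sup>2 * h))"
  have R1: "\<bar>R1\<bar> \<le> B * (4 * \<bar>\<mu>\<bar> ^ 3 + 8 * \<sigma> ^ 3) * ?H"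
    unfolding R1_def T_def w_def[symmetric]
  proof (rule gauss_moment_expansion[where \<phi> = "\<lambda>s. F (w * exp s)"])
    show "(\<lambda>s. F (w * exp s)) \<in> borel_measurable borel" by measurable
  qed (use h \<sigma> B_nonneg log_taylor[OF w(1)] w(1) in \<open>auto simp: F_pos\<close>)
  define R2 where "R2 = f x - (f w + h * f1 w)"
  have R2: "\<bar>R2\<bar> \<le> B * h\<^sup>2" unfolding R2_def w(2) using forward_taylor[OF w(1) h(1)] .
  define R3 where "R3 = \<mu>\<^sup>2 * h\<^sup>2 * ((w\<^sup>2 * f2 w + w * f1 w) / 2)"
  have R3: "\<bar>R3\<bar> \<le> \<mu>\<^sup>2 * h\<^sup>2 * B"
  proof -
    have "\<bar>(w\<^sup>2 * f2 w + w * f1 w) / 2\<bar> \<le> B"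
      using weighted_bound(1,2)[OF w(1)] by (simp add: abs_le_iff)
    from mult_left_mono[OF this, of "\<mu>\<^sup>2 * h\<^sup>2"] show ?thesis
      unfolding R3_def abs_mult[of "\<mu>\<^sup>2 * h\<^sup>2"] by simp
  qed
  have R4: "\<bar>lam * h * (f w - f x)\<bar> \<le> 2 * lam * B * h\<^sup>2"
  proof -
    have "\<bar>f w - f x\<bar> \<le> \<bar>R2\<bar> + \<bar>h * f1 w\<bar>" unfolding R2_def by linarith
    also have "\<bar>h * f1 w\<bar> \<le> B * h" using bound(2)[OF w(1)] h by (simp add: abs_mult)
    also have "B * h\<^sup>2 \<le> B * h" using h B_nonneg by (intro mult_left_mono) (auto simp: power2_eq_square mult_left_le)
    with R2 have "\<bar>R2\<bar> + B * h \<le> 2 * B * h" by linarith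
    finally have "lam * h * \<bar>f w - f x\<bar> \<le> lam * h * (2 * B * h)"
      using lam h by (intro mult_left_mono) auto
    then show ?thesis using lam h by (simp add: abs_mult power2_eq_square mult_ac)
  qed
  \<comment> \<open>The differential equation at w. Its drift -1 leaves \<open>f1 w\<close> on the
    right, and f w + h f1 w is \<open>f x\<close> up to second order.\<close>
  have "\<mu> * (w * f1 w) + \<sigma>\<^sup>2 / 2 * (w\<^sup>2 * f2 w + w * f1 w) = f1 w + lam * f w"
    using ode[OF w(1)] by (simp add: algebra_simps)
  then have "h * (\<mu> * (w * f1 w) + \<sigma>\<^sup>2 / 2 * (w\<^sup>2 * f2 w + w * f1 w)) = h * (f1 w + lam * f w)" by simp
  then have "T h x = f w + h * f1 w + h * lam * f w + R3 + R1"
    unfolding R1_def R3_def by (simp add: algebra_simps add_divide_distrib)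
  then have T: "T h x = (1 + lam * h) * f x + (lam * h * (f w - f x) - R2 + R3 + R1)"
    unfolding R2_def by (simp add: algebra_simps)
  define R where "R = lam * h * (f w - f x) - R2 + R3 + R1"
  have "\<bar>R\<bar> \<le> 2 * lam * B * h\<^sup>2 + B * h\<^sup>2 + \<mu>\<^sup>2 * h\<^sup>2 * B + B * (4 * \<bar>\<mu>\<bar> ^ 3 + 8 * \<sigma> ^ 3) * ?H"
    unfolding R_def using R1 R2 R3 R4 by linarith
  moreover have "2 * lam * B * h\<^sup>2 + B * h\<^sup>2 + \<mu>\<^sup>2 * h\<^sup>2 * B = (2 * lam * B + B + \<mu>\<^sup>2 * B) * h\<^sup>2"
    by (simp add: algebra_simps)
  moreover have "(2 * lam * B + B + \<mu>\<^sup>2 * B) * h\<^sup>2 \<le> (2 * lam * B + B + \<mu>\<^sup>2 * B) * ?H"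
    using h2 lam B_nonneg by (intro mult_left_mono) auto
  ultimately have R: "\<bar>R\<bar> \<le> (2 * lam * B + B + \<mu>\<^sup>2 * B) * ?H + B * (4 * \<bar>\<mu>\<bar> ^ 3 + 8 * \<sigma> ^ 3) * ?H"
    by linarith
  let ?u = "lam * h" and ?r = "exp (- lam * h)"
  have u: "?u > 0" using lam h by simp
  have r: "?r * (1 + ?u) \<le> 1" "1 - ?u\<^sup>2 \<le> ?r * (1 + ?u)" "?r \<le> 1"
  proof -
    have "?r * (1 + ?u) \<le> ?r * exp ?u" by (intro mult_left_mono exp_ge_add_one_self) auto
    also have "\<dots> = 1" by (simp add: exp_minus)
    finally show "?r * (1 + ?u) \<le> 1" .
    have "1 - ?u \<le> ?r" using exp_ge_add_one_self[of "- ?u"] by simp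
    then have "(1 - ?u) * (1 + ?u) \<le> ?r * (1 + ?u)" using u by (intro mult_right_mono) auto
    then show "1 - ?u\<^sup>2 \<le> ?r * (1 + ?u)" by (simp add: power2_eq_square algebra_simps)
    show "?r \<le> 1" using u by simp
  qed
  have "?r * T h x - f x = (?r * (1 + ?u) - 1) * f x + ?r * R"
    unfolding T R_def[symmetric] by (simp add: algebra_simps)
  then have "\<bar>?r * T h x - f x\<bar> \<le> \<bar>?r * (1 + ?u) - 1\<bar> * \<bar>f x\<bar> + ?r * \<bar>R\<bar>"
    using abs_triangle_ineq[of "(?r * (1 + ?u) - 1) * f x" "?r * R"] by (simp add: abs_mult)
  also have "\<dots> \<le> ?u\<^sup>2 * B + 1 * \<bar>R\<bar>"
    using r bound(1)[of x] w h by (intro add_mono mult_mono) auto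
  also have "?u\<^sup>2 * B \<le> lam\<^sup>2 * B * ?H"
    using mult_left_mono[OF h2, of "lam\<^sup>2 * B"] B_nonneg by (simp add: power_mult_distrib mult_ac)
  finally show ?thesis using R by (simp add: C_def algebra_simps)
qed

text \<open>On nonpositive states the left side is exactly 0. For 0 < x \<le> h the chain is
  absorbed in the next step, so \<open>T h x = 1\<close> and the error only reflects how close
  \<open>f\<close> is to its boundary value; that error is charged to the indicator.\<close>

lemma one_step:
  assumes h: "0 < h" "h \<le> 1" and \<eta>: "\<And>x. 0 < x \<Longrightarrow> x \<le> h \<Longrightarrow> \<bar>exp (- lam * h) - f x\<bar> \<le> \<eta>"
  shows "\<bar>exp (- lam * h) * T h x - F x + (1 - exp (- lam * h)) * indicator {..0} x\<bar>
    \<le> C * (h * sqrt h) + \<eta> * indicator {0<..h} x"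
proof -
  have "C \<ge> 0" unfolding C_def using B_nonneg lam \<sigma> by simp
  then have C: "C * (h * sqrt h) \<ge> 0" using h by simp
  consider "x \<le> 0" | "0 < x" "x \<le> h" | "x > h" by linarith
  then show ?thesis
  proof cases
    case 1 then show ?thesis using C T_le[of h x] h by simp
  next
    case 2 then show ?thesis using C T_le[of h x] h \<eta>[of x] by (simp add: F_pos)
  next
    case 3 then show ?thesis using one_step_error[OF h 3] h by (simp add: F_pos)
  qed
qed

end

section \<open>Discounted sums, Riemann sums and Fatou\<close>

text \<open>In the application \<open>e j\<close> is the expectation of \<open>F\<close> after
  \<open>j\<close> steps and \<open>p j\<close> the probability of absorption by then. Weighting the
  step inequality with r^j makes the e-terms telescope. The increments of \<open>p\<close> sum to at
  most 1, so \<eta> is paid once in total and not once per step.\<close>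

lemma discounted_telescope:
  fixes e p :: "nat \<Rightarrow> real"
  assumes r: "0 < r" "r < 1" and e: "\<And>j. \<bar>e j\<bar> \<le> K" and p: "\<And>j. 0 \<le> p j" "\<And>j. p j \<le> 1"
    and mono: "\<And>j. p j \<le> p (Suc j)" and nonneg: "\<epsilon> \<ge> 0" "\<eta> \<ge> 0"
    and step: "\<And>j. \<bar>r * e (Suc j) - e j + (1 - r) * p j\<bar> \<le> \<epsilon> + \<eta> * (p (Suc j) - p j)"
  shows "\<bar>(1 - r) * (\<Sum>j. r ^ j * p j) - e 0\<bar> \<le> \<epsilon> / (1 - r) + \<eta>"
proof -
  have sr: "summable (\<lambda>j. r ^ j)" using r by (intro summable_geometric) auto
  have sp: "summable (\<lambda>j. r ^ j * p j)"
    by (rule summable_comparison_test'[OF sr, of 0]) (use r p in \<open>auto simp: mult_left_le\<close>)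
  have id: "(1 - r) * (\<Sum>j<n. r ^ j * p j) - e 0 + r ^ n * e n
      = (\<Sum>j<n. r ^ j * (r * e (Suc j) - e j + (1 - r) * p j))" for n
    by (induction n) (auto simp: algebra_simps)
  have partial: "\<bar>(1 - r) * (\<Sum>j<n. r ^ j * p j) - e 0 + r ^ n * e n\<bar> \<le> \<epsilon> / (1 - r) + \<eta>" for n
  proof -
    have "\<bar>(1 - r) * (\<Sum>j<n. r ^ j * p j) - e 0 + r ^ n * e n\<bar>
        \<le> (\<Sum>j<n. \<bar>r ^ j * (r * e (Suc j) - e j + (1 - r) * p j)\<bar>)"
      unfolding id by (rule sum_abs)
    also have "\<dots> \<le> (\<Sum>j<n. \<epsilon> * r ^ j + \<eta> * (p (Suc j) - p j))"
    proof (rule sum_mono)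
      fix j
      have "\<bar>r ^ j * (r * e (Suc j) - e j + (1 - r) * p j)\<bar>
          \<le> r ^ j * (\<epsilon> + \<eta> * (p (Suc j) - p j))"
        unfolding abs_mult using step[of j] r by (simp add: mult_left_mono)
      \<comment> \<open>The discount is dropped from the second term only: undiscounted increments
        telescope, whereas the constant \<epsilon> needs the geometric sum.\<close>
      also have "\<dots> \<le> \<epsilon> * r ^ j + \<eta> * (p (Suc j) - p j)"
      proof -
        have "r ^ j \<le> 1" using r by (intro power_le_one) auto
        moreover have "\<eta> * (p (Suc j) - p j) \<ge> 0" using mono[of j] nonneg by simp
        ultimately have "r ^ j * (\<eta> * (p (Suc j) - p j)) \<le> 1 * (\<eta> * (p (Suc j) - p j))"
          by (rule mult_right_mono)
        then show ?thesis by (simp add: distrib_left mult.commute)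
      qed
      finally show "\<bar>r ^ j * (r * e (Suc j) - e j + (1 - r) * p j)\<bar> \<le> \<epsilon> * r ^ j + \<eta> * (p (Suc j) - p j)" .
    qed
    also have "\<dots> = \<epsilon> * (\<Sum>j<n. r ^ j) + \<eta> * (p n - p 0)"
      by (simp add: sum.distrib sum_distrib_left[symmetric] sum_lessThan_telescope)
    also have "\<dots> \<le> \<epsilon> * (1 / (1 - r)) + \<eta> * 1"
    proof (intro add_mono mult_left_mono nonneg)
      show "(\<Sum>j<n. r ^ j) \<le> 1 / (1 - r)"
        using sum_le_suminf[OF sr, of "{..<n}"] suminf_geometric[of r] r by simp
      show "p n - p 0 \<le> 1" using p(2)[of n] p(1)[of 0] by linarith
    qed
    finally show ?thesis by simp
  qed
  have "(\<lambda>n. r ^ n * e n) \<longlonglongrightarrow> 0"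
  proof (rule Lim_null_comparison)
    show "\<forall>\<^sub>F n in sequentially. norm (r ^ n * e n) \<le> r ^ n * K"
      using e r by (intro always_eventually) (auto simp: abs_mult mult_left_mono)
    show "(\<lambda>n. r ^ n * K) \<longlonglongrightarrow> 0"
      using r by (intro tendsto_mult_left_zero LIMSEQ_power_zero) auto
  qed
  then have "(\<lambda>n. \<bar>(1 - r) * (\<Sum>j<n. r ^ j * p j) - e 0 + r ^ n * e n\<bar>)
      \<longlonglongrightarrow> \<bar>(1 - r) * (\<Sum>j. r ^ j * p j) - e 0 + 0\<bar>"
    by (intro tendsto_intros summable_LIMSEQ sp)
  then show ?thesis using partial by (intro LIMSEQ_le_const2) auto
qed

text \<open>The mesh need not divide \<open>t\<close>. Half of \<epsilon> goes to uniform continuity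
  on the full cells, the other half to the leftover interval of length at most
  \<open>h\<close>.\<close>

lemma left_riemann_sum_approx:
  fixes g :: "real \<Rightarrow> real"
  assumes g: "continuous_on {0..} g" and t: "t \<ge> 0" and "\<epsilon> > 0"
  shows "\<exists>\<delta>>0. \<forall>h. 0 < h \<and> h < \<delta> \<longrightarrow>
    \<bar>(\<Sum>i<nat \<lfloor>t / h\<rfloor>. h * g (real i * h)) - integral {0..t} g\<bar> < \<epsilon>"
proof -
  have gc: "continuous_on {a..b} g" if "0 \<le> a" for a b
    by (rule continuous_on_subset[OF g]) (use that in auto)
  have gi: "g integrable_on {a..b}" if "0 \<le> a" for a b
    by (rule integrable_continuous_interval[OF gc[OF that]])
  have "bounded (g ` {0..t})"
    by (intro compact_imp_bounded compact_continuous_image gc) auto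
  then obtain K where K: "\<And>s. s \<in> {0..t} \<Longrightarrow> \<bar>g s\<bar> \<le> K" unfolding bounded_iff by fastforce
  have "K \<ge> 0" using K[of 0] t by simp
  \<comment> \<open>\<open>t + 1\<close> in place of \<open>t\<close> keeps the quotient meaningful
    at \<open>t = 0\<close>; \<open>K + 1\<close> below does the same for \<open>K\<close>.\<close>
  define \<epsilon>' where "\<epsilon>' = \<epsilon> / (2 * (t + 1))"
  have \<epsilon>': "\<epsilon>' > 0" using \<open>\<epsilon> > 0\<close> t by (simp add: \<epsilon>'_def)
  have "uniformly_continuous_on {0..t} g"
    by (intro compact_uniformly_continuous gc) auto
  then obtain \<delta>1 where \<delta>1: "\<delta>1 > 0"
    "\<And>x y. x \<in> {0..t} \<Longrightarrow> y \<in> {0..t} \<Longrightarrow> dist x y < \<delta>1 \<Longrightarrow> dist (g x) (g y) < \<epsilon>'"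
    unfolding uniformly_continuous_on_def using \<epsilon>' by metis
  define \<delta> where "\<delta> = min \<delta>1 (\<epsilon> / (2 * (K + 1)))"
  have "\<delta> > 0" using \<delta>1 \<open>K \<ge> 0\<close> \<open>\<epsilon> > 0\<close> by (simp add: \<delta>_def)
  moreover have "\<bar>(\<Sum>i<nat \<lfloor>t / h\<rfloor>. h * g (real i * h)) - integral {0..t} g\<bar> < \<epsilon>"
    if h: "0 < h" "h < \<delta>" for h
  proof -
    have part: "\<bar>(\<Sum>i<n. h * g (real i * h)) - integral {0..real n * h} g\<bar> \<le> real n * h * \<epsilon>'"
      if "real n * h \<le> t" for n
      using that
    proof (induction n)
      case (Suc n)
      let ?a = "real n * h" and ?b = "real (Suc n) * h"
      have ab: "0 \<le> ?a" "?a \<le> ?b" "?b \<le> t" "?b - ?a = h" using h Suc.prems by (auto simp: algebra_simps)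
      have "integral {0..?b} g = integral {0..?a} g + integral {?a..?b} g"
        using ab by (intro Henstock_Kurzweil_Integration.integral_combine[symmetric] gi) auto
      moreover have "\<bar>h * g ?a - integral {?a..?b} g\<bar> \<le> \<epsilon>' * h"
      proof -
        have "integral {?a..?b} (\<lambda>s. g ?a - g s) = integral {?a..?b} (\<lambda>s. g ?a) - integral {?a..?b} g"
          using ab by (intro Henstock_Kurzweil_Integration.integral_diff gi) auto
        also have "integral {?a..?b} (\<lambda>s. g ?a) = h * g ?a" using ab by simp
        finally have "norm (h * g ?a - integral {?a..?b} g) = norm (integral {?a..?b} (\<lambda>s. g ?a - g s))"
          by simp
        also have "\<dots> \<le> \<epsilon>' * (?b - ?a)"
        proof (rule integral_bound)
          show "continuous_on {?a..?b} (\<lambda>s. g ?a - g s)" using ab by (intro continuous_intros gc) auto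
          fix s assume s: "s \<in> {?a..?b}"
          then have s': "?a \<le> s" "s \<le> ?b" by (simp_all only: atLeastAtMost_iff)
          have "?a \<in> {0..t}" unfolding atLeastAtMost_iff using ab(1-3) by linarith
          moreover have "s \<in> {0..t}" unfolding atLeastAtMost_iff using ab(1-3) s' by linarith
          moreover have "dist ?a s < \<delta>1"
          proof -
            have "h < \<delta>1" using h by (simp add: \<delta>_def)
            then show ?thesis using s' ab(4) unfolding dist_real_def by linarith
          qed
          ultimately have "dist (g ?a) (g s) < \<epsilon>'" by (rule \<delta>1(2))
          then show "norm (g ?a - g s) \<le> \<epsilon>'" by (simp add: dist_norm)
        qed (use ab in auto)
        finally show ?thesis using ab(4) by simp
      qed
      moreover have "\<bar>(\<Sum>i<n. h * g (real i * h)) - integral {0..?a} g\<bar> \<le> ?a * \<epsilon>'"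
        using Suc.IH ab by simp
      ultimately have "\<bar>(\<Sum>i<Suc n. h * g (real i * h)) - integral {0..?b} g\<bar> \<le> ?a * \<epsilon>' + \<epsilon>' * h"
        by simp
      then show ?case by (simp add: algebra_simps)
    qed simp
    define n where "n = nat \<lfloor>t / h\<rfloor>"
    have "real n \<le> t / h" "t / h < real n + 1" unfolding n_def using t h by (auto simp: floor_correct)
    then have n: "real n * h \<le> t" "t - real n * h \<le> h" using h by (auto simp: field_simps)
    have "integral {0..t} g = integral {0..real n * h} g + integral {real n * h..t} g"
      using n h by (intro Henstock_Kurzweil_Integration.integral_combine[symmetric] gi) auto
    moreover have "norm (integral {real n * h..t} g) \<le> K * (t - real n * h)"
    proof (rule integral_bound)
      have "0 \<le> real n * h" using h by simp
      then show "continuous_on {real n * h..t} g" by (rule gc)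
      show "norm (g s) \<le> K" if "s \<in> {real n * h..t}" for s
      proof -
        have "s \<in> {0..t}"
          using that \<open>0 \<le> real n * h\<close> unfolding atLeastAtMost_iff by linarith
        then show ?thesis using K by simp
      qed
    qed (rule n)
    moreover have "K * (t - real n * h) \<le> K * h" by (rule mult_left_mono[OF n(2) \<open>K \<ge> 0\<close>])
    moreover have "K * h < \<epsilon> / 2"
    proof -
      have "K * h \<le> (K + 1) * h" using h by (simp add: algebra_simps)
      also have "\<dots> < (K + 1) * (\<epsilon> / (2 * (K + 1)))"
        using h \<open>K \<ge> 0\<close> unfolding \<delta>_def by (intro mult_strict_left_mono) auto
      also have "\<dots> = \<epsilon> / 2" using \<open>K \<ge> 0\<close> by (simp add: field_simps)
      finally show ?thesis .
    qed
    moreover have "real n * h * \<epsilon>' \<le> \<epsilon> / 2"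
    proof -
      have "real n * h * \<epsilon>' \<le> (t + 1) * \<epsilon>'" using n \<epsilon>' by (intro mult_right_mono) auto
      also have "\<dots> = \<epsilon> / 2" unfolding \<epsilon>'_def using t by (simp add: field_simps)
      finally show ?thesis .
    qed
    ultimately show ?thesis using part[OF n(1)] unfolding n_def[symmetric] real_norm_def by linarith
  qed
  ultimately show ?thesis by blast
qed

text \<open>Fatou's lemma for sets: \<open>A\<close> lies in the increasing union of the tail
  intersections \<open>D n\<close>, along which the measure is continuous.\<close>

lemma (in finite_measure) measure_eventually_gt:
  assumes A: "A \<in> sets M" and An: "\<And>n. An n \<in> sets M"
    and ev: "\<And>\<omega>. \<omega> \<in> A \<Longrightarrow> \<forall>\<^sub>F n in sequentially. \<omega> \<in> An n" and c: "c < measure M A"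
  shows "\<forall>\<^sub>F n in sequentially. c < measure M (An n)"
proof -
  define D where "D n = (\<Inter>m\<in>{n..}. An m)" for n
  have D: "D n \<in> sets M" for n unfolding D_def using An by (intro sets.countable_INT') auto
  have "incseq D" by (auto simp: incseq_def D_def)
  have "A \<subseteq> (\<Union>n. D n)" using ev unfolding D_def eventually_sequentially by (force simp: Ball_def)
  then have "measure M A \<le> measure M (\<Union>n. D n)" using D by (intro finite_measure_mono) auto
  with c have "c < measure M (\<Union>n. D n)" by simp
  moreover have "(\<lambda>n. measure M (D n)) \<longlonglongrightarrow> measure M (\<Union>n. D n)"
    using D \<open>incseq D\<close> by (intro finite_Lim_measure_incseq) auto
  ultimately have "\<forall>\<^sub>F n in sequentially. c < measure M (D n)" by (rule order_tendstoD(1)[rotated])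
  moreover have "measure M (D n) \<le> measure M (An n)" for n
    using D An by (intro finite_measure_mono) (auto simp: D_def)
  ultimately show ?thesis by (auto elim!: eventually_mono intro: less_le_trans)
qed

lemma nn_integral_exponential_interval:
  fixes lam a b :: real
  assumes "lam > 0" "a \<le> b"
  shows "(\<integral>\<^sup>+t. ennreal (lam * exp (- lam * t)) * indicator {a..<b} t \<partial>lborel)
    = ennreal (exp (- lam * a) - exp (- lam * b))"
proof -
  have "(\<integral>\<^sup>+t. ennreal (lam * exp (- lam * t)) * indicator {a..<b} t \<partial>lborel)
      = (\<integral>\<^sup>+t. ennreal (lam * exp (- lam * t)) * indicator {a..b} t \<partial>lborel)"
    by (intro nn_integral_cong_AE eventually_mono[OF AE_lborel_singleton[of b]])
      (auto simp: indicator_def)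
  also have "\<dots> = ennreal (- exp (- lam * b) - (- exp (- lam * a)))"
    using assms by (intro nn_integral_FTC_Icc) (auto intro!: derivative_eq_intros)
  finally show ?thesis by simp
qed

text \<open>An exponential time of rate \<open>lam\<close>, rounded down to the grid of mesh
  \<open>h\<close>, is geometric with ratio exp (- lam h). This identifies the discounted sum over
  steps with an integral over time.\<close>

lemma nn_integral_exponential_step:
  fixes lam h :: real and p :: "nat \<Rightarrow> real"
  assumes "lam > 0" "h > 0" and p: "\<And>j. 0 \<le> p j" "\<And>j. p j \<le> 1"
  shows "(\<integral>\<^sup>+t. ennreal (lam * exp (- lam * t) * p (nat \<lfloor>t / h\<rfloor>)) * indicator {0..} t \<partial>lborel)
    = ennreal ((1 - exp (- lam * h)) * (\<Sum>j. exp (- lam * h) ^ j * p j))"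
proof -
  let ?r = "exp (- lam * h)"
  have r: "0 < ?r" "?r < 1" using assms by auto
  have sr: "summable (\<lambda>j. ?r ^ j)" using r by (intro summable_geometric) auto
  have sp: "summable (\<lambda>j. ?r ^ j * p j)"
    by (rule summable_comparison_test'[OF sr, of 0]) (use r p in \<open>auto simp: mult_left_le abs_mult\<close>)
  let ?I = "\<lambda>j. {real j * h..<real (Suc j) * h}"
  have pt: "ennreal (lam * exp (- lam * t) * p (nat \<lfloor>t / h\<rfloor>)) * indicator {0..} t
      = (\<Sum>j. ennreal (p j) * (ennreal (lam * exp (- lam * t)) * indicator (?I j) t))" for t
  proof (cases "t \<ge> 0")
    case True
    have mem: "t \<in> ?I j \<longleftrightarrow> j = nat \<lfloor>t / h\<rfloor>" for j
    proof -
      have "t \<in> ?I j \<longleftrightarrow> real j \<le> t / h \<and> t / h < real j + 1"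
        using assms by (auto simp: field_simps)
      also have "\<dots> \<longleftrightarrow> \<lfloor>t / h\<rfloor> = int j" by (simp add: floor_eq_iff)
      also have "\<dots> \<longleftrightarrow> j = nat \<lfloor>t / h\<rfloor>" using True assms by (auto)
      finally show ?thesis .
    qed
    have "(\<Sum>j. ennreal (p j) * (ennreal (lam * exp (- lam * t)) * indicator (?I j) t))
        = (\<Sum>j\<in>{nat \<lfloor>t / h\<rfloor>}. ennreal (p j) * (ennreal (lam * exp (- lam * t)) * indicator (?I j) t))"
      by (rule suminf_finite) (use mem in \<open>auto simp: indicator_def\<close>)
    also have "\<dots> = ennreal (p (nat \<lfloor>t / h\<rfloor>)) * ennreal (lam * exp (- lam * t))"
      using mem[of "nat \<lfloor>t / h\<rfloor>"] by simp
    also have "\<dots> = ennreal (lam * exp (- lam * t) * p (nat \<lfloor>t / h\<rfloor>)) * indicator {0..} t"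
      using True assms p by (simp add: ennreal_mult mult_ac)
    finally show ?thesis by simp
  next
    case False
    have "t \<notin> ?I j" for j
    proof
      assume "t \<in> ?I j"
      then have "real j * h \<le> t" by simp
      moreover have "real j * h \<ge> 0" using assms by simp
      ultimately show False using False by linarith
    qed
    then show ?thesis using False by simp
  qed
  have "(\<integral>\<^sup>+t. ennreal (lam * exp (- lam * t) * p (nat \<lfloor>t / h\<rfloor>)) * indicator {0..} t \<partial>lborel)
      = (\<Sum>j. \<integral>\<^sup>+t. ennreal (p j) * (ennreal (lam * exp (- lam * t)) * indicator (?I j) t) \<partial>lborel)"
    unfolding pt by (intro nn_integral_suminf) auto
  also have "\<dots> = (\<Sum>j. ennreal ((1 - ?r) * (?r ^ j * p j)))"
  proof (rule suminf_cong)
    fix j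
    have e: "exp (- lam * (real j * h)) - exp (- lam * (real (Suc j) * h)) = (1 - ?r) * ?r ^ j"
    proof -
      have "exp (- lam * (real i * h)) = ?r ^ i" for i
        by (simp add: exp_of_nat_mult[symmetric] mult_ac)
      from this[of j] this[of "Suc j"] show ?thesis by (simp only: power_Suc) (simp add: algebra_simps)
    qed
    have "(\<integral>\<^sup>+t. ennreal (p j) * (ennreal (lam * exp (- lam * t)) * indicator (?I j) t) \<partial>lborel)
        = ennreal (p j) * ennreal ((1 - ?r) * ?r ^ j)"
    proof -
      have "real j * h \<le> real (Suc j) * h" using assms by (intro mult_right_mono) auto
      from nn_integral_exponential_interval[OF \<open>lam > 0\<close> this]
      show ?thesis unfolding e by (subst nn_integral_cmult) auto
    qed
    also have "\<dots> = ennreal ((1 - ?r) * (?r ^ j * p j))"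
      using p[of j] r by (simp add: ennreal_mult[symmetric] mult_ac)
    finally show "(\<integral>\<^sup>+t. ennreal (p j) * (ennreal (lam * exp (- lam * t)) * indicator (?I j) t) \<partial>lborel)
        = ennreal ((1 - ?r) * (?r ^ j * p j))" .
  qed
  also have "\<dots> = ennreal (\<Sum>j. (1 - ?r) * (?r ^ j * p j))"
    using r p by (intro suminf_ennreal2 summable_mult sp) auto
  also have "(\<Sum>j. (1 - ?r) * (?r ^ j * p j)) = (1 - ?r) * (\<Sum>j. ?r ^ j * p j)"
    by (rule suminf_mult[OF sp])
  finally show ?thesis .
qed

text \<open>Lower semicontinuity is assumed through thresholds \<open>c\<close>, the form in which
  \<open>measure_eventually_gt\<close> delivers it and in which \<open>le_Liminf_iff\<close>
  consumes it.\<close>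

lemma nn_integral_exponential_fatou:
  fixes lam L :: real and Q :: "real \<Rightarrow> real" and q :: "nat \<Rightarrow> real \<Rightarrow> real" and S :: "nat \<Rightarrow> real"
  assumes "lam > 0" and [measurable]: "Q \<in> borel_measurable borel" "\<And>n. q n \<in> borel_measurable borel"
    and low: "\<And>t c. t > 0 \<Longrightarrow> c < Q t \<Longrightarrow> \<forall>\<^sub>F n in sequentially. c < q n t"
    and int: "\<And>n. (\<integral>\<^sup>+t. ennreal (lam * exp (- lam * t) * q n t) * indicator {0..} t \<partial>lborel) = ennreal (S n)"
    and lim: "S \<longlonglongrightarrow> L"
  shows "(\<integral>\<^sup>+t. ennreal (lam * exp (- lam * t) * Q t) * indicator {0<..} t \<partial>lborel) \<le> ennreal L"
proof -
  have "(\<integral>\<^sup>+t. ennreal (lam * exp (- lam * t) * Q t) * indicator {0<..} t \<partial>lborel)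
      \<le> (\<integral>\<^sup>+t. liminf (\<lambda>n. ennreal (lam * exp (- lam * t) * q n t) * indicator {0..} t) \<partial>lborel)"
  proof (rule nn_integral_mono)
    fix t
    show "ennreal (lam * exp (- lam * t) * Q t) * indicator {0<..} t
        \<le> liminf (\<lambda>n. ennreal (lam * exp (- lam * t) * q n t) * indicator {0..} t)"
    proof (cases "t > 0")
      case True
      let ?w = "lam * exp (- lam * t)"
      have w: "?w > 0" using \<open>lam > 0\<close> by simp
      have "ennreal (?w * Q t) \<le> liminf (\<lambda>n. ennreal (?w * q n t))"
        unfolding le_Liminf_iff
      proof (intro allI impI)
        fix y :: ennreal assume y: "y < ennreal (?w * Q t)"
        then have "y < top" by (rule order_less_trans) (rule ennreal_less_top)
        then obtain y' where y': "y = ennreal y'" "y' \<ge> 0" by (cases y) auto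
        then have "y' < ?w * Q t" using y by (simp add: ennreal_less_iff)
        then have "y' / ?w < Q t" using w by (simp only: pos_divide_less_eq mult.commute)
        from low[OF True this] show "\<forall>\<^sub>F n in sequentially. y < ennreal (?w * q n t)"
        proof eventually_elim
          case (elim n)
          then have "y' < ?w * q n t" using w by (simp only: pos_divide_less_eq mult.commute)
          then show ?case using y' by (simp add: ennreal_less_iff)
        qed
      qed
      then show ?thesis using True by simp
    qed simp
  qed
  also have "\<dots> \<le> liminf (\<lambda>n. \<integral>\<^sup>+t. ennreal (lam * exp (- lam * t) * q n t) * indicator {0..} t \<partial>lborel)"
    by (rule nn_integral_liminf) auto
  also have "\<dots> = liminf (\<lambda>n. ennreal (S n))" by (simp only: int)
  also have "\<dots> = ennreal L"
    using lim by (intro lim_imp_Liminf tendsto_ennrealI) auto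
  finally show ?thesis .
qed

section \<open>The discretised exponential functional\<close>

text \<open>With \<open>d\<close> the increments of \<open>W\<close> at mesh \<open>h\<close> this is \<open>(y - J) exp (\<mu> t + \<sigma> W)\<close>, where \<open>J\<close> is the
  left Riemann sum of the exponential functional. It is nonpositive iff \<open>J \<ge> y\<close>.\<close>

primrec budget :: "real \<Rightarrow> real \<Rightarrow> real \<Rightarrow> real \<Rightarrow> (nat \<Rightarrow> real) \<Rightarrow> nat \<Rightarrow> real" where
  "budget \<mu> \<sigma> h y d 0 = y"
| "budget \<mu> \<sigma> h y d (Suc j) = (budget \<mu> \<sigma> h y d j - h) * exp (\<mu> * h + \<sigma> * d j)"

text \<open>Exhibits the state after \<open>j\<close> steps as a function of the first
  \<open>j\<close> increments, hence independent of the next one.\<close>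

lemma budget_restrict: "j \<le> n \<Longrightarrow> budget \<mu> \<sigma> h y (restrict d {..<n}) j = budget \<mu> \<sigma> h y d j"
  by (induction j) auto

lemma budget_measurable_PiM:
  "j \<le> n \<Longrightarrow> (\<lambda>d. budget \<mu> \<sigma> h y d j) \<in> borel_measurable (PiM {..<n} (\<lambda>_. borel))"
proof (induction j)
  case (Suc j)
  have [measurable]: "(\<lambda>d. d j) \<in> borel_measurable (PiM {..<n} (\<lambda>_. borel :: real measure))"
    using Suc.prems by (intro measurable_component_singleton) auto
  have [measurable]: "(\<lambda>d. budget \<mu> \<sigma> h y d j) \<in> borel_measurable (PiM {..<n} (\<lambda>_. borel))"
    using Suc by simp
  show ?case by simp
qed simp

definition left_sum :: "real \<Rightarrow> real \<Rightarrow> real \<Rightarrow> (real \<Rightarrow> 'a \<Rightarrow> real) \<Rightarrow> nat \<Rightarrow> 'a \<Rightarrow> real" where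
  "left_sum \<mu> \<sigma> h W j \<omega> = (\<Sum>i<j. h * exp (- (\<mu> * (real i * h) + \<sigma> * W (real i * h) \<omega>)))"

text \<open>Each increment factor carries exp (s j) to exp (s (j+1)). Subtracting \<open>h\<close>
  before multiplying lowers the unscaled budget by h exp (- s j), the integrand at the left
  endpoint.\<close>

lemma budget_eq:
  assumes "W 0 \<omega> = 0"
  shows "budget \<mu> \<sigma> h y (\<lambda>i. W (real (Suc i) * h) \<omega> - W (real i * h) \<omega>) j
    = (y - left_sum \<mu> \<sigma> h W j \<omega>) * exp (\<mu> * (real j * h) + \<sigma> * W (real j * h) \<omega>)"
proof (induction j)
  case 0
  then show ?case using assms by (simp add: left_sum_def)
next
  case (Suc j)
  define s where "s i = \<mu> * (real i * h) + \<sigma> * W (real i * h) \<omega>" for i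
  have e: "exp (\<mu> * h + \<sigma> * (W (real (Suc j) * h) \<omega> - W (real j * h) \<omega>)) = exp (s (Suc j)) * exp (- s j)"
    unfolding exp_add[symmetric] s_def by (simp add: algebra_simps)
  have "exp (s j) * exp (- s j) = 1" by (simp add: exp_minus)
  then have "((y - left_sum \<mu> \<sigma> h W j \<omega>) * exp (s j) - h) * (exp (s (Suc j)) * exp (- s j))
      = (y - (left_sum \<mu> \<sigma> h W j \<omega> + h * exp (- s j))) * exp (s (Suc j))" by algebra
  moreover have "left_sum \<mu> \<sigma> h W (Suc j) \<omega> = left_sum \<mu> \<sigma> h W j \<omega> + h * exp (- s j)"
    by (simp add: left_sum_def s_def)
  ultimately show ?case
    unfolding budget.simps Suc.IH e s_def[symmetric] by (simp only:)
qed

lemma left_sum_tendsto_expfun: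
  assumes "\<omega> \<in> space M" "std_brownian_motion M W" "t \<ge> 0"
  shows "(\<lambda>m. left_sum \<mu> \<sigma> (1 / real (Suc m)) W (nat \<lfloor>t / (1 / real (Suc m))\<rfloor>) \<omega>) \<longlonglongrightarrow> expfun \<mu> \<sigma> W t \<omega>"
proof (rule LIMSEQ_I)
  fix e :: real assume "e > 0"
  have "continuous_on {0..} (\<lambda>t. W t \<omega>)" using assms by (simp add: std_brownian_motion_def)
  then have "continuous_on {0..} (\<lambda>s. exp (- (\<mu> * s + \<sigma> * W s \<omega>)))" by (intro continuous_intros)
  from left_riemann_sum_approx[OF this \<open>t \<ge> 0\<close> \<open>e > 0\<close>]
  obtain \<delta> where \<delta>: "\<delta> > 0" "\<And>h. 0 < h \<Longrightarrow> h < \<delta> \<Longrightarrow>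
      \<bar>left_sum \<mu> \<sigma> h W (nat \<lfloor>t / h\<rfloor>) \<omega> - expfun \<mu> \<sigma> W t \<omega>\<bar> < e"
    unfolding left_sum_def expfun_def by blast
  obtain m0 where m0: "1 / real (Suc m0) < \<delta>" using nat_approx_posE[OF \<open>\<delta> > 0\<close>] by blast
  have small: "1 / real (Suc m) < \<delta>" if "m \<ge> m0" for m
  proof -
    have "1 / real (Suc m) \<le> 1 / real (Suc m0)" using that by (intro divide_left_mono) auto
    with m0 show ?thesis by simp
  qed
  show "\<exists>m0. \<forall>m\<ge>m0. norm (left_sum \<mu> \<sigma> (1 / real (Suc m)) W (nat \<lfloor>t / (1 / real (Suc m))\<rfloor>) \<omega>
      - expfun \<mu> \<sigma> W t \<omega>) < e"
    unfolding real_norm_def using small by (intro exI[of _ m0] allI impI \<delta>(2)) simp_all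
qed

lemma abs_integral_le_integral:
  fixes u v :: "'b \<Rightarrow> real"
  assumes "integrable N u" "integrable N v" "\<And>x. x \<in> space N \<Longrightarrow> \<bar>u x\<bar> \<le> v x"
  shows "\<bar>\<integral>x. u x \<partial>N\<bar> \<le> (\<integral>x. v x \<partial>N)"
proof -
  have "\<bar>\<integral>x. u x \<partial>N\<bar> \<le> (\<integral>x. \<bar>u x\<bar> \<partial>N)" by (rule integral_abs_bound)
  also have "\<dots> \<le> (\<integral>x. v x \<partial>N)" by (rule integral_mono) (use assms in auto)
  finally show ?thesis .
qed

text \<open>The Markov property in the form used: Fubini for the product law of \<open>X\<close> and
  \<open>N\<close>, with \<open>X\<close> frozen while \<open>N\<close> is integrated against its
  density.\<close>

lemma (in prob_space) indep_var_expectation: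
  fixes X N :: "'a \<Rightarrow> real" and g :: "real \<times> real \<Rightarrow> real"
  assumes ind: "indep_var borel X borel N"
    and [measurable]: "g \<in> borel_measurable (borel \<Otimes>\<^sub>M borel)" and bnd: "\<And>z. \<bar>g z\<bar> \<le> K"
    and N: "distributed M lborel N \<phi>" "\<And>n. \<phi> n \<ge> (0::real)"
  shows "(\<integral>\<omega>. g (X \<omega>, N \<omega>) \<partial>M) = (\<integral>\<omega>. (\<integral>n. \<phi> n * g (X \<omega>, n) \<partial>lborel) \<partial>M)"
proof -
  have [measurable]: "X \<in> borel_measurable M" "N \<in> borel_measurable M"
    using ind by (auto dest: indep_var_rv1 indep_var_rv2)
  have [measurable]: "\<phi> \<in> borel_measurable borel"
    using distributed_real_measurable[OF N(2,1)] by simp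
  interpret X: prob_space "distr M borel X" by (rule prob_space_distr) simp
  interpret N: prob_space "distr M borel N" by (rule prob_space_distr) simp
  interpret P: pair_prob_space "distr M borel X" "distr M borel N" ..
  have eq: "distr M borel X \<Otimes>\<^sub>M distr M borel N = distr M (borel \<Otimes>\<^sub>M borel) (\<lambda>\<omega>. (X \<omega>, N \<omega>))"
    using ind by (simp add: indep_var_distribution_eq)
  have "(\<integral>\<omega>. g (X \<omega>, N \<omega>) \<partial>M) = integral\<^sup>L (distr M borel X \<Otimes>\<^sub>M distr M borel N) g"
    unfolding eq by (subst integral_distr) auto
  also have "\<dots> = (\<integral>x. (\<integral>n. g (x, n) \<partial>distr M borel N) \<partial>distr M borel X)"
    by (rule P.integral_fst'[symmetric], rule P.P.integrable_const_bound[where B = K])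
       (use bnd in auto)
  also have "\<dots> = (\<integral>x. (\<integral>n. \<phi> n * g (x, n) \<partial>lborel) \<partial>distr M borel X)"
  proof (rule Bochner_Integration.integral_cong[OF refl])
    fix x
    show "(\<integral>n. g (x, n) \<partial>distr M borel N) = (\<integral>n. \<phi> n * g (x, n) \<partial>lborel)"
      using distributed_integral[OF N(1), of "\<lambda>n. g (x, n)"] N(2)
      by (subst integral_distr) auto
  qed
  also have "\<dots> = (\<integral>\<omega>. (\<integral>n. \<phi> n * g (X \<omega>, n) \<partial>lborel) \<partial>M)"
    by (subst integral_distr) auto
  finally show ?thesis .
qed

section \<open>Discounted absorption probabilities of the budget chain\<close>

context resolvent_solution
begin

lemma T_measurable [measurable]: "T h \<in> borel_measurable borel"
  unfolding T_def by measurable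

lemma T_bound:
  assumes "h > 0"
  shows "\<bar>T h x\<bar> \<le> B + 1"
proof -
  let ?d = "normal_density 0 (sqrt h)"
  have i: "integrable lborel ?d" using assms by simp
  have "\<bar>T h x\<bar> \<le> (\<integral>n. (B + 1) * ?d n \<partial>lborel)" unfolding T_def
  proof (rule abs_integral_le_integral)
    have le: "\<bar>?d n * F z\<bar> \<le> (B + 1) * ?d n" for n z
      unfolding abs_mult using F_bound[of z] by (simp add: mult.commute mult_right_mono)
    then show "\<bar>?d n * F ((x - h) * exp (\<mu> * h + \<sigma> * n))\<bar> \<le> (B + 1) * ?d n" for n .
    show "integrable lborel (\<lambda>n. (B + 1) * ?d n)" using i by simp
    then show "integrable lborel (\<lambda>n. ?d n * F ((x - h) * exp (\<mu> * h + \<sigma> * n)))"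
      by (rule Bochner_Integration.integrable_bound)
        (use le in \<open>auto intro!: AE_I2 intro: order_trans[OF _ abs_ge_self]\<close>)
  qed
  also have "\<dots> = B + 1" using assms by simp
  finally show ?thesis .
qed

text \<open>As 1 - exp (- lam h) is of order lam h, the first error term is of order sqrt h.\<close>

lemma discrete_resolvent:
  assumes bm: "std_brownian_motion M W" and h: "0 < h" "h \<le> 1" and y: "y > 0"
    and \<eta>: "\<And>x. 0 < x \<Longrightarrow> x \<le> h \<Longrightarrow> \<bar>exp (- lam * h) - f x\<bar> \<le> \<eta>"
  shows "\<bar>(1 - exp (- lam * h)) * (\<Sum>j. exp (- lam * h) ^ j *
      measure M {\<omega> \<in> space M. y \<le> left_sum \<mu> \<sigma> h W j \<omega>}) - f y\<bar>
    \<le> C * (h * sqrt h) / (1 - exp (- lam * h)) + \<eta>"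
proof -
  interpret prob_space M using bm by (simp add: std_brownian_motion_def)
  define d where "d i \<omega> = W (real (Suc i) * h) \<omega> - W (real i * h) \<omega>" for i \<omega>
  define X where "X j \<omega> = budget \<mu> \<sigma> h y (\<lambda>i. d i \<omega>) j" for j \<omega>
  let ?r = "exp (- lam * h)"
  have W [measurable]: "W t \<in> borel_measurable M" if "t \<ge> 0" for t
    using bm that by (simp add: std_brownian_motion_def)
  have d_meas [measurable]: "d i \<in> borel_measurable M" for i
    unfolding d_def using h by (intro borel_measurable_diff W) auto
  have X_meas [measurable]: "X j \<in> borel_measurable M" for j
  proof (induction j)
    case (Suc j)
    then have [measurable]: "X j \<in> borel_measurable M" .
    have "X (Suc j) = (\<lambda>\<omega>. (X j \<omega> - h) * exp (\<mu> * h + \<sigma> * d j \<omega>))" by (auto simp: X_def)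
    then show ?case by simp
  qed (simp add: X_def)
  have d_dist: "distributed M lborel (d j) (normal_density 0 (sqrt h))" for j
  proof -
    have *: "\<forall>s t. 0 \<le> s \<and> s < t \<longrightarrow>
        distributed M lborel (\<lambda>\<omega>. W t \<omega> - W s \<omega>) (normal_density 0 (sqrt (t - s)))"
      using bm unfolding std_brownian_motion_def by (elim conjE)
    have "0 \<le> real j * h \<and> real j * h < real (Suc j) * h" using h by simp
    from *[rule_format, OF this]
    have "distributed M lborel (\<lambda>\<omega>. W (real (Suc j) * h) \<omega> - W (real j * h) \<omega>)
        (normal_density 0 (sqrt (real (Suc j) * h - real j * h)))" .
    moreover have "real (Suc j) * h - real j * h = h" by (simp add: algebra_simps)
    ultimately show ?thesis by (simp add: d_def[abs_def])
  qed
  have d_indep: "indep_vars (\<lambda>_. borel) d {..<n}" for n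
  proof -
    have *: "\<forall>(n::nat) (ts::nat \<Rightarrow> real). 0 \<le> ts 0 \<and> (\<forall>i<n. ts i < ts (Suc i)) \<longrightarrow>
        indep_vars (\<lambda>_. borel) (\<lambda>i \<omega>. W (ts (Suc i)) \<omega> - W (ts i) \<omega>) {..<n}"
      using bm unfolding std_brownian_motion_def by (elim conjE)
    have "0 \<le> real 0 * h \<and> (\<forall>i<n. real i * h < real (Suc i) * h)" using h by simp
    with *[THEN spec, of n, THEN spec, of "\<lambda>i. real i * h"]
    have "indep_vars (\<lambda>_. borel) (\<lambda>i \<omega>. W (real (Suc i) * h) \<omega> - W (real i * h) \<omega>) {..<n}"
      by (rule mp)
    then show ?thesis by (simp add: d_def[abs_def])
  qed
  have indep: "indep_var borel (X j) borel (d j)" for j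
  proof -
    have "indep_var borel ((\<lambda>e. budget \<mu> \<sigma> h y e j) \<circ> (\<lambda>\<omega>. restrict (\<lambda>i. d i \<omega>) {..<j}))
        borel ((\<lambda>e. e j) \<circ> (\<lambda>\<omega>. restrict (\<lambda>i. d i \<omega>) {j}))"
      by (rule indep_var_compose[OF indep_var_restrict[OF d_indep[of "Suc j"], of "{..<j}" "{j}"]])
        (auto intro: budget_measurable_PiM)
    then show ?thesis by (simp add: comp_def budget_restrict X_def[abs_def])
  qed
  define e where "e j = expectation (\<lambda>\<omega>. F (X j \<omega>))" for j
  define p where "p j = prob {\<omega> \<in> space M. X j \<omega> \<le> 0}" for j
  have e_Suc: "e (Suc j) = expectation (\<lambda>\<omega>. T h (X j \<omega>))" for j
  proof -
    have "e (Suc j) = expectation (\<lambda>\<omega>. (\<lambda>(x, n). F ((x - h) * exp (\<mu> * h + \<sigma> * n))) (X j \<omega>, d j \<omega>))"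
      by (simp add: e_def X_def)
    also have "\<dots> = expectation (\<lambda>\<omega>. \<integral>n. normal_density 0 (sqrt h) n *
        (\<lambda>(x, n). F ((x - h) * exp (\<mu> * h + \<sigma> * n))) (X j \<omega>, n) \<partial>lborel)"
      by (rule indep_var_expectation[OF indep _ _ d_dist, where K = "B + 1"])
        (auto simp: F_bound split: prod.split)
    finally show ?thesis by (simp add: T_def)
  qed
  have intF: "integrable M (\<lambda>\<omega>. F (X j \<omega>))" for j
    by (rule integrable_const_bound[where B = "B + 1"]) (auto simp: F_bound)
  have intT: "integrable M (\<lambda>\<omega>. T h (X j \<omega>))" for j
    by (rule integrable_const_bound[where B = "B + 1"]) (auto simp: T_bound h)
  \<comment> \<open>The next state is nonpositive exactly when the present one is at most
    \<open>h\<close>, so the increment of \<open>p\<close> is the probability of the boundary layer.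
    This matches the indicator in \<open>one_step\<close> with the hypothesis of
    \<open>discounted_telescope\<close>.\<close>
  have p_Suc: "p (Suc j) - p j = prob {\<omega> \<in> space M. X j \<omega> \<in> {0<..h}}" for j
  proof -
    have "X (Suc j) \<omega> \<le> 0 \<longleftrightarrow> X j \<omega> \<le> h" for \<omega> by (simp add: X_def mult_le_0_iff)
    then have "p (Suc j) = prob {\<omega> \<in> space M. X j \<omega> \<le> h}" by (simp add: p_def)
    moreover have "{\<omega> \<in> space M. X j \<omega> \<in> {0<..h}} = {\<omega> \<in> space M. X j \<omega> \<le> h} - {\<omega> \<in> space M. X j \<omega> \<le> 0}"
      using h by auto
    moreover have "prob ({\<omega> \<in> space M. X j \<omega> \<le> h} - {\<omega> \<in> space M. X j \<omega> \<le> 0})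
        = prob {\<omega> \<in> space M. X j \<omega> \<le> h} - prob {\<omega> \<in> space M. X j \<omega> \<le> 0}"
      using h by (intro finite_measure_Diff) auto
    ultimately show ?thesis by (simp add: p_def)
  qed
  have step: "\<bar>?r * e (Suc j) - e j + (1 - ?r) * p j\<bar> \<le> C * (h * sqrt h) + \<eta> * (p (Suc j) - p j)" for j
  proof -
    let ?A = "{\<omega> \<in> space M. X j \<omega> \<le> 0}" and ?A' = "{\<omega> \<in> space M. X j \<omega> \<in> {0<..h}}"
    have iA: "integrable M (indicator ?A :: _ \<Rightarrow> real)" "integrable M (indicator ?A' :: _ \<Rightarrow> real)"
      by (auto intro!: integrable_real_indicator simp: less_top[symmetric])
    have eq: "?r * e (Suc j) - e j + (1 - ?r) * p j
        = expectation (\<lambda>\<omega>. ?r * T h (X j \<omega>) - F (X j \<omega>) + (1 - ?r) * indicator ?A \<omega>)"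
      using intF intT iA unfolding e_Suc unfolding e_def p_def by simp
    have "\<bar>?r * e (Suc j) - e j + (1 - ?r) * p j\<bar> \<le> expectation (\<lambda>\<omega>. C * (h * sqrt h) + \<eta> * indicator ?A' \<omega>)"
      unfolding eq
    proof (rule abs_integral_le_integral)
      show "integrable M (\<lambda>\<omega>. ?r * T h (X j \<omega>) - F (X j \<omega>) + (1 - ?r) * indicator ?A \<omega>)"
        by (intro Bochner_Integration.integrable_add Bochner_Integration.integrable_diff
            integrable_mult_right intT intF iA)
      show "integrable M (\<lambda>\<omega>. C * (h * sqrt h) + \<eta> * indicator ?A' \<omega>)"
        by (intro Bochner_Integration.integrable_add integrable_mult_right integrable_const iA)
      fix \<omega> assume \<omega>: "\<omega> \<in> space M"
      have i: "indicator {..0} (X j \<omega>) = (indicator ?A \<omega> :: real)"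
        "indicator {0<..h} (X j \<omega>) = (indicator ?A' \<omega> :: real)" using \<omega> by (auto simp: indicator_def)
      from one_step[OF h \<eta>, of "X j \<omega>", unfolded i]
      show "\<bar>?r * T h (X j \<omega>) - F (X j \<omega>) + (1 - ?r) * indicator ?A \<omega>\<bar>
          \<le> C * (h * sqrt h) + \<eta> * indicator ?A' \<omega>" .
    qed
    also have "\<dots> = C * (h * sqrt h) + \<eta> * prob ?A'"
      using iA by (simp add: prob_space)
    finally show ?thesis unfolding p_Suc .
  qed
  have "C \<ge> 0" unfolding C_def using B_nonneg lam \<sigma> by simp
  have "\<eta> \<ge> 0" using \<eta>[of h] h by linarith
  have "\<bar>(1 - ?r) * (\<Sum>j. ?r ^ j * p j) - e 0\<bar> \<le> C * (h * sqrt h) / (1 - ?r) + \<eta>"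
  proof (rule discounted_telescope[where K = "B + 1"])
    show "\<bar>e j\<bar> \<le> B + 1" for j
    proof -
      have "\<bar>e j\<bar> \<le> expectation (\<lambda>\<omega>. B + 1)" unfolding e_def
        using intF F_bound by (intro abs_integral_le_integral) auto
      then show ?thesis by (simp add: prob_space)
    qed
    show "p j \<le> p (Suc j)" for j
      using p_Suc[of j] measure_nonneg[of M "{\<omega> \<in> space M. X j \<omega> \<in> {0<..h}}"] by linarith
    show "C * (h * sqrt h) \<ge> 0" using \<open>C \<ge> 0\<close> h by simp
    show "0 \<le> p j" "p j \<le> 1" for j by (simp_all add: p_def)
    show "\<bar>?r * e (Suc j) - e j + (1 - ?r) * p j\<bar> \<le> C * (h * sqrt h) + \<eta> * (p (Suc j) - p j)" for j
      by (rule step)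
    show "\<eta> \<ge> 0" by fact
  qed (use lam h in simp_all)
  moreover have "e 0 = f y" using y by (simp add: e_def X_def F_pos prob_space)
  moreover have "p j = measure M {\<omega> \<in> space M. y \<le> left_sum \<mu> \<sigma> h W j \<omega>}" for j
  proof -
    have "X j \<omega> \<le> 0 \<longleftrightarrow> y \<le> left_sum \<mu> \<sigma> h W j \<omega>" if "\<omega> \<in> space M" for \<omega>
    proof -
      have "W 0 \<omega> = 0" using bm that by (simp add: std_brownian_motion_def)
      from budget_eq[of W \<omega>, OF this] show ?thesis by (simp add: X_def d_def mult_le_0_iff)
    qed
    then show ?thesis unfolding p_def by (intro arg_cong[where f = prob]) auto
  qed
  ultimately show ?thesis by simp
qed

end

section \<open>Passage to the limit\<close>

text \<open>The constant sequence 1 on the unit grid turns the total mass into a geometric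
  series.\<close>

lemma has_bochner_integral_exponential:
  fixes lam :: real
  assumes "lam > 0"
  shows "has_bochner_integral lborel (\<lambda>t. lam * exp (- lam * t) * indicator {0<..} t) 1"
proof (rule has_bochner_integral_nn_integral)
  have "(\<integral>\<^sup>+t. ennreal (lam * exp (- lam * t) * indicator {0<..} t) \<partial>lborel)
      = (\<integral>\<^sup>+t. ennreal (lam * exp (- lam * t) * 1) * indicator {0..} t \<partial>lborel)"
    by (intro nn_integral_cong_AE eventually_mono[OF AE_lborel_singleton[of 0]])
      (auto simp: indicator_def)
  also have "\<dots> = ennreal ((1 - exp (- lam * 1)) * (\<Sum>j. exp (- lam * 1) ^ j * 1))"
    by (rule nn_integral_exponential_step[OF assms, of 1 "\<lambda>_. 1"]) auto
  also have "\<dots> = ennreal 1"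
    using assms suminf_geometric[of "exp (- lam)"] by simp
  finally show "(\<integral>\<^sup>+t. ennreal (lam * exp (- lam * t) * indicator {0<..} t) \<partial>lborel) = ennreal 1" .
qed (use assms in auto)

lemma expfun_integrand_continuous:
  assumes "std_brownian_motion M W" "\<omega> \<in> space M"
  shows "continuous_on {0..t} (\<lambda>s. exp (- (\<mu> * s + \<sigma> * W s \<omega>)))"
proof -
  have "continuous_on {0..} (\<lambda>t. W t \<omega>)" using assms by (simp add: std_brownian_motion_def)
  then have "continuous_on {0..t} (\<lambda>t. W t \<omega>)" by (rule continuous_on_subset) auto
  then show ?thesis by (intro continuous_intros)
qed

lemma expfun_mono:
  assumes "std_brownian_motion M W" "\<omega> \<in> space M" "s \<le> t"
  shows "expfun \<mu> \<sigma> W s \<omega> \<le> expfun \<mu> \<sigma> W t \<omega>"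
  unfolding expfun_def
  by (intro integral_subset_le integrable_continuous_interval expfun_integrand_continuous[OF assms(1,2)])
    (use assms in auto)

lemma expfun_pos:
  assumes "std_brownian_motion M W" "\<omega> \<in> space M" "t > 0"
  shows "expfun \<mu> \<sigma> W t \<omega> > 0"
proof -
  have c: "continuous_on {0..t} (\<lambda>s. exp (- (\<mu> * s + \<sigma> * W s \<omega>)))"
    by (rule expfun_integrand_continuous[OF assms(1,2)])
  have "expfun \<mu> \<sigma> W t \<omega> \<noteq> 0"
  proof
    assume "expfun \<mu> \<sigma> W t \<omega> = 0"
    then have "\<forall>x\<in>{0..t}. exp (- (\<mu> * x + \<sigma> * W x \<omega>)) = 0"
      unfolding expfun_def using integral_eq_0_iff[OF c] assms(3) by simp
    then show False using assms(3) by auto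
  qed
  moreover have "expfun \<mu> \<sigma> W t \<omega> \<ge> 0"
    unfolding expfun_def by (intro Henstock_Kurzweil_Integration.integral_nonneg integrable_continuous_interval c) auto
  ultimately show ?thesis by simp
qed

lemma left_sum_measurable:
  assumes "std_brownian_motion M W" "h \<ge> 0"
  shows "left_sum \<mu> \<sigma> h W j \<in> borel_measurable M"
proof -
  have "W (real i * h) \<in> borel_measurable M" for i
    using assms by (simp add: std_brownian_motion_def)
  then show ?thesis unfolding left_sum_def[abs_def] by measurable
qed

lemma expfun_measurable:
  assumes "std_brownian_motion M W" "t \<ge> 0"
  shows "expfun \<mu> \<sigma> W t \<in> borel_measurable M"
proof (rule borel_measurable_LIMSEQ_real)
  show "left_sum \<mu> \<sigma> (1 / real (Suc m)) W (nat \<lfloor>t / (1 / real (Suc m))\<rfloor>) \<in> borel_measurable M" for m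
    by (rule left_sum_measurable[OF assms(1)]) simp
  fix \<omega> assume "\<omega> \<in> space M"
  then show "(\<lambda>m. left_sum \<mu> \<sigma> (1 / real (Suc m)) W (nat \<lfloor>t / (1 / real (Suc m))\<rfloor>) \<omega>)
      \<longlonglongrightarrow> expfun \<mu> \<sigma> W t \<omega>"
    by (rule left_sum_tendsto_expfun[OF _ assms])
qed

text \<open>Monotonicity on the whole line makes the distribution function Borel in
  \<open>t\<close>, as the Laplace integral requires.\<close>

lemma cdfI_antimono:
  assumes bm: "std_brownian_motion M W" and y: "y \<ge> 0"
  shows "antimono (\<lambda>t. cdfI M \<mu> \<sigma> W t y)"
proof (rule antimonoI)
  fix s t :: real assume "s \<le> t"
  interpret prob_space M using bm by (simp add: std_brownian_motion_def)
  have meas: "{\<omega> \<in> space M. expfun \<mu> \<sigma> W s \<omega> \<le> y} \<in> sets M" for s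
  proof (cases "s \<ge> 0")
    case True
    have [measurable]: "expfun \<mu> \<sigma> W s \<in> borel_measurable M" by (rule expfun_measurable[OF bm True])
    show ?thesis by measurable
  next
    case False
    \<comment> \<open>For negative times the integral over the empty interval is 0, so the event is
      the whole space.\<close>
    then show ?thesis using y by (simp add: expfun_def)
  qed
  show "cdfI M \<mu> \<sigma> W t y \<le> cdfI M \<mu> \<sigma> W s y"
    unfolding cdfI_def using expfun_mono[OF bm _ \<open>s \<le> t\<close>, of _ \<mu> \<sigma>] meas
    by (intro finite_measure_mono) (auto intro: order_trans)
qed

lemma cdfI_measurable:
  assumes "std_brownian_motion M W" "y \<ge> 0"
  shows "(\<lambda>t. cdfI M \<mu> \<sigma> W t y) \<in> borel_measurable borel"
proof -
  have "mono (\<lambda>t. - cdfI M \<mu> \<sigma> W t y)"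
    using cdfI_antimono[OF assms, of \<mu> \<sigma>] by (auto simp: mono_def antimono_def)
  from borel_measurable_uminus[OF borel_measurable_mono[OF this]] show ?thesis by simp
qed

context resolvent_solution
begin

lemma discrete_resolvent_limit:
  assumes bm: "std_brownian_motion M W" and y: "y > 0"
  shows "(\<lambda>m. (1 - exp (- lam * (1 / real (Suc m)))) * (\<Sum>j. exp (- lam * (1 / real (Suc m))) ^ j *
      measure M {\<omega> \<in> space M. y \<le> left_sum \<mu> \<sigma> (1 / real (Suc m)) W j \<omega>})) \<longlonglongrightarrow> f y"
    (is "?S \<longlonglongrightarrow> _")
proof (rule LIMSEQ_I)
  fix e :: real assume e: "e > 0"
  let ?h = "\<lambda>m. 1 / real (Suc m)"
  have h0: "?h \<longlonglongrightarrow> 0" by real_asymp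
  have "(\<lambda>m. (?h m * sqrt (?h m)) / (1 - exp (- lam * ?h m))) \<longlonglongrightarrow> 0"
    using lam by real_asymp
  then have "(\<lambda>m. C * ((?h m * sqrt (?h m)) / (1 - exp (- lam * ?h m)))) \<longlonglongrightarrow> 0"
    by (rule tendsto_mult_right_zero)
  then have 1: "\<forall>\<^sub>F m in sequentially. C * (?h m * sqrt (?h m)) / (1 - exp (- lam * ?h m)) < e / 2"
    using order_tendstoD(2)[OF _ half_gt_zero[OF e]] unfolding times_divide_eq_right by blast
  have "(\<lambda>m. exp (- lam * ?h m)) \<longlonglongrightarrow> 1" by real_asymp
  then have 2: "\<forall>\<^sub>F m in sequentially. \<bar>exp (- lam * ?h m) - 1\<bar> < e / 4"
    unfolding dist_real_def[symmetric] using e by (intro tendstoD) simp_all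
  have "\<forall>\<^sub>F x in at_right 0. dist (f x) 1 < e / 4" using at_0 e by (intro tendstoD) auto
  then obtain \<delta> where \<delta>: "\<delta> > 0" "\<And>x. 0 < x \<Longrightarrow> x < \<delta> \<Longrightarrow> \<bar>f x - 1\<bar> < e / 4"
    unfolding eventually_at_right_field dist_real_def by auto
  have 3: "\<forall>\<^sub>F m in sequentially. ?h m < \<delta>" using order_tendstoD(2)[OF h0 \<delta>(1)] .
  from 1 2 3 have "\<forall>\<^sub>F m in sequentially. norm (?S m - f y) < e"
  proof eventually_elim
    case (elim m)
    have "\<bar>exp (- lam * ?h m) - f x\<bar> \<le> e / 2" if "0 < x" "x \<le> ?h m" for x
      using \<delta>(2)[of x] elim that by linarith
    from discrete_resolvent[OF bm _ _ y this] have "\<bar>?S m - f y\<bar>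
        \<le> C * (?h m * sqrt (?h m)) / (1 - exp (- lam * ?h m)) + e / 2" by simp
    with elim(1) show ?case unfolding real_norm_def by linarith
  qed
  then show "\<exists>m0. \<forall>m\<ge>m0. norm (?S m - f y) < e" by (simp add: eventually_sequentially)
qed

text \<open>Pathwise convergence of the left sums bounds the tail integral above through the events
  J \<ge> y, and below through the complementary events J < x with x > y. The slack x > y is needed
  because a functional equal to y may have approximants above y.\<close>

theorem laplP_eq:
  assumes bm: "std_brownian_motion M W" and y: "y > 0"
  shows "laplP M \<mu> \<sigma> W y lam = f y / lam"
proof -
  interpret prob_space M using bm by (simp add: std_brownian_motion_def)
  let ?h = "\<lambda>m. 1 / real (Suc m)"
  let ?r = "\<lambda>m. exp (- lam * ?h m)"
  define p where "p x m j = prob {\<omega> \<in> space M. x \<le> left_sum \<mu> \<sigma> (?h m) W j \<omega>}" for x m j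
  define S where "S x m = (1 - ?r m) * (\<Sum>j. ?r m ^ j * p x m j)" for x m
  have S: "S x \<longlonglongrightarrow> f x" if "x > 0" for x
    unfolding S_def p_def by (rule discrete_resolvent_limit[OF bm that])
  have p01: "0 \<le> p x m j" "p x m j \<le> 1" for x m j by (auto simp: p_def)
  have r: "0 < ?r m" "?r m < 1" for m using lam by auto
  have sr: "summable (\<lambda>j. ?r m ^ j)" for m using r[of m] by (intro summable_geometric) auto
  have sp: "summable (\<lambda>j. ?r m ^ j * p x m j)" for x m
    by (rule summable_comparison_test'[OF sr[of m], of 0]) (use p01 in \<open>auto simp: mult_left_le abs_mult\<close>)
  have S': "(1 - ?r m) * (\<Sum>j. ?r m ^ j * (1 - p x m j)) = 1 - S x m" for x m
  proof -
    have "(\<Sum>j. ?r m ^ j * (1 - p x m j)) = (\<Sum>j. ?r m ^ j) - (\<Sum>j. ?r m ^ j * p x m j)"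
      using suminf_diff[OF sr[of m] sp[of m x]] by (simp add: right_diff_distrib)
    also have "(\<Sum>j. ?r m ^ j) = 1 / (1 - ?r m)" using r[of m] by (intro suminf_geometric) auto
    finally have "(1 - ?r m) * (\<Sum>j. ?r m ^ j * (1 - p x m j))
        = (1 - ?r m) * (1 / (1 - ?r m)) - (1 - ?r m) * (\<Sum>j. ?r m ^ j * p x m j)"
      by (simp only: right_diff_distrib)
    also have "(1 - ?r m) * (1 / (1 - ?r m)) = 1" using r[of m] lam by simp
    finally show ?thesis by (simp only: S_def)
  qed
  have S_nonneg: "S x m \<ge> 0" for x m
    unfolding S_def using r[of m] p01 by (intro mult_nonneg_nonneg suminf_nonneg sp) auto
  have S_le: "1 - S x m \<ge> 0" for x m
  proof -
    have "summable (\<lambda>j. ?r m ^ j * (1 - p x m j))"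
      using summable_diff[OF sr[of m] sp[of m x]] by (simp add: right_diff_distrib)
    then show ?thesis unfolding S'[symmetric] using r[of m] p01
      by (intro mult_nonneg_nonneg suminf_nonneg) auto
  qed
  \<comment> \<open>These bounds come from the discrete quantities, not from the formula for
    \<open>f\<close>. They make the passage from \<open>ennreal\<close> back to real inequalities
    legitimate.\<close>
  have f01: "0 \<le> f x" "0 \<le> 1 - f x" if "x > 0" for x
  proof -
    show "0 \<le> f x" by (rule LIMSEQ_le_const[OF S[OF that]]) (use S_nonneg in blast)
    show "0 \<le> 1 - f x"
      by (rule LIMSEQ_le_const[OF tendsto_diff[OF tendsto_const S[OF that]]]) (use S_le in blast)
  qed
  let ?c = "\<lambda>t. cdfI M \<mu> \<sigma> W t y"
  have c_meas [measurable]: "?c \<in> borel_measurable borel" by (rule cdfI_measurable[OF bm]) (use y in simp)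
  have c01: "0 \<le> ?c t" "?c t \<le> 1" for t by (auto simp: cdfI_def)
  let ?E = "\<lambda>t. lam * exp (- lam * t) * indicator {0<..} t"
  note E = has_bochner_integral_exponential[OF lam]
  have intE: "integrable lborel ?E" using E by (rule integrable.intros)
  have int: "integrable lborel (\<lambda>t. ?E t * u t)" if [measurable]: "u \<in> borel_measurable borel" and "\<And>t. 0 \<le> u t" "\<And>t. u t \<le> 1" for u
    by (rule Bochner_Integration.integrable_bound[OF intE])
      (use that lam in \<open>auto simp: abs_mult mult_left_le\<close>)
  have ennint: "ennreal (\<integral>t. ?E t * u t \<partial>lborel)
      = (\<integral>\<^sup>+t. ennreal (lam * exp (- lam * t) * u t) * indicator {0<..} t \<partial>lborel)"
    if "u \<in> borel_measurable borel" and "\<And>t. 0 \<le> u t" "\<And>t. u t \<le> 1" for u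
  proof -
    have "ennreal (\<integral>t. ?E t * u t \<partial>lborel) = (\<integral>\<^sup>+t. ennreal (?E t * u t) \<partial>lborel)"
      using int[OF that] that lam by (intro nn_integral_eq_integral[symmetric]) auto
    also have "\<dots> = (\<integral>\<^sup>+t. ennreal (lam * exp (- lam * t) * u t) * indicator {0<..} t \<partial>lborel)"
      by (intro nn_integral_cong) (auto simp: indicator_def)
    finally show ?thesis .
  qed
  have floor_meas [measurable]: "(\<lambda>t. u (nat \<lfloor>t / ?h m\<rfloor>)) \<in> borel_measurable borel"
    for u :: "nat \<Rightarrow> real" and m by measurable
  have I_meas: "expfun \<mu> \<sigma> W t \<in> borel_measurable M" if "t > 0" for t
    using expfun_measurable[OF bm] that by simp
  have J_meas [measurable]: "left_sum \<mu> \<sigma> (?h m) W j \<in> borel_measurable M" for m j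
    by (rule left_sum_measurable[OF bm]) simp
  have upper: "(\<integral>t. ?E t * (1 - ?c t) \<partial>lborel) \<le> f y"
  proof -
    have "(\<integral>\<^sup>+t. ennreal (lam * exp (- lam * t) * (1 - ?c t)) * indicator {0<..} t \<partial>lborel) \<le> ennreal (f y)"
    proof (rule nn_integral_exponential_fatou[OF lam _ _ _ _ S[OF y], where q = "\<lambda>m t. p y m (nat \<lfloor>t / ?h m\<rfloor>)"])
      show "(\<integral>\<^sup>+t. ennreal (lam * exp (- lam * t) * p y m (nat \<lfloor>t / ?h m\<rfloor>)) * indicator {0..} t \<partial>lborel)
          = ennreal (S y m)" for m
        unfolding S_def by (rule nn_integral_exponential_step[OF lam _ p01]) simp
      fix t c :: real assume t: "t > 0" and c: "c < 1 - ?c t"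
      have [measurable]: "expfun \<mu> \<sigma> W t \<in> borel_measurable M" by (rule I_meas[OF t])
      have "1 - ?c t = prob (space M - {\<omega> \<in> space M. expfun \<mu> \<sigma> W t \<omega> \<le> y})"
        unfolding cdfI_def by (rule prob_compl[symmetric]) measurable
      also have "space M - {\<omega> \<in> space M. expfun \<mu> \<sigma> W t \<omega> \<le> y} = {\<omega> \<in> space M. y < expfun \<mu> \<sigma> W t \<omega>}"
        by auto
      finally have c': "c < prob {\<omega> \<in> space M. y < expfun \<mu> \<sigma> W t \<omega>}" using c by simp
      show "\<forall>\<^sub>F m in sequentially. c < p y m (nat \<lfloor>t / ?h m\<rfloor>)"
        unfolding p_def
      proof (rule measure_eventually_gt[OF _ _ _ c'])
        fix \<omega> assume "\<omega> \<in> {\<omega> \<in> space M. y < expfun \<mu> \<sigma> W t \<omega>}"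
        then have \<omega>: "\<omega> \<in> space M" "y < expfun \<mu> \<sigma> W t \<omega>" by auto
        from order_tendstoD(1)[OF left_sum_tendsto_expfun[OF \<omega>(1) bm] \<omega>(2)] t
        have "\<forall>\<^sub>F m in sequentially. y < left_sum \<mu> \<sigma> (?h m) W (nat \<lfloor>t / ?h m\<rfloor>) \<omega>" by simp
        then show "\<forall>\<^sub>F m in sequentially. \<omega> \<in> {\<omega> \<in> space M. y \<le> left_sum \<mu> \<sigma> (?h m) W (nat \<lfloor>t / ?h m\<rfloor>) \<omega>}"
          by eventually_elim (use \<omega> in auto)
      qed measurable
    qed measurable
    then have "ennreal (\<integral>t. ?E t * (1 - ?c t) \<partial>lborel) \<le> ennreal (f y)"
      by (subst ennint) (use c01 in auto)
    then show ?thesis by (simp only: ennreal_le_iff[OF f01(1)[OF y]])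
  qed
  have lower: "(\<integral>t. ?E t * ?c t \<partial>lborel) \<le> 1 - f x" if x: "x > y" for x
  proof -
    have xp: "x > 0" using x y by simp
    have lim: "(\<lambda>m. 1 - S x m) \<longlonglongrightarrow> 1 - f x" by (intro tendsto_intros S[OF xp])
    have "(\<integral>\<^sup>+t. ennreal (lam * exp (- lam * t) * ?c t) * indicator {0<..} t \<partial>lborel) \<le> ennreal (1 - f x)"
    proof (rule nn_integral_exponential_fatou[OF lam _ _ _ _ lim, where q = "\<lambda>m t. 1 - p x m (nat \<lfloor>t / ?h m\<rfloor>)"])
      show "(\<integral>\<^sup>+t. ennreal (lam * exp (- lam * t) * (1 - p x m (nat \<lfloor>t / ?h m\<rfloor>))) * indicator {0..} t \<partial>lborel)
          = ennreal (1 - S x m)" for m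
        unfolding S'[symmetric]
        by (rule nn_integral_exponential_step[OF lam, of "?h m" "\<lambda>j. 1 - p x m j"]) (use p01 in auto)
      fix t c :: real assume t: "t > 0" and c: "c < ?c t"
      have [measurable]: "expfun \<mu> \<sigma> W t \<in> borel_measurable M" by (rule I_meas[OF t])
      have q: "1 - p x m j = prob {\<omega> \<in> space M. left_sum \<mu> \<sigma> (?h m) W j \<omega> < x}" for m j
      proof -
        have "1 - p x m j = prob (space M - {\<omega> \<in> space M. x \<le> left_sum \<mu> \<sigma> (?h m) W j \<omega>})"
          unfolding p_def by (rule prob_compl[symmetric]) measurable
        also have "space M - {\<omega> \<in> space M. x \<le> left_sum \<mu> \<sigma> (?h m) W j \<omega>}
            = {\<omega> \<in> space M. left_sum \<mu> \<sigma> (?h m) W j \<omega> < x}" by auto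
        finally show ?thesis .
      qed
      show "\<forall>\<^sub>F m in sequentially. c < 1 - p x m (nat \<lfloor>t / ?h m\<rfloor>)"
        unfolding q
      proof (rule measure_eventually_gt[OF _ _ _ c[unfolded cdfI_def]])
        fix \<omega> assume "\<omega> \<in> {\<omega> \<in> space M. expfun \<mu> \<sigma> W t \<omega> \<le> y}"
        then have \<omega>: "\<omega> \<in> space M" "expfun \<mu> \<sigma> W t \<omega> < x" using x by auto
        from order_tendstoD(2)[OF left_sum_tendsto_expfun[OF \<omega>(1) bm] \<omega>(2)] t
        have "\<forall>\<^sub>F m in sequentially. left_sum \<mu> \<sigma> (?h m) W (nat \<lfloor>t / ?h m\<rfloor>) \<omega> < x" by simp
        then show "\<forall>\<^sub>F m in sequentially. \<omega> \<in> {\<omega> \<in> space M. left_sum \<mu> \<sigma> (?h m) W (nat \<lfloor>t / ?h m\<rfloor>) \<omega> < x}"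
          by eventually_elim (use \<omega> in auto)
      qed measurable
    qed measurable
    then have "ennreal (\<integral>t. ?E t * ?c t \<partial>lborel) \<le> ennreal (1 - f x)"
      by (subst ennint) (use c01 in auto)
    then show ?thesis by (simp only: ennreal_le_iff[OF f01(2)[OF xp]])
  qed
  have total: "(\<integral>t. ?E t * (1 - ?c t) \<partial>lborel) = 1 - (\<integral>t. ?E t * ?c t \<partial>lborel)"
  proof -
    have "(\<integral>t. ?E t * (1 - ?c t) \<partial>lborel) = (\<integral>t. ?E t - ?E t * ?c t \<partial>lborel)"
      by (simp only: right_diff_distrib mult_1_right)
    also have "\<dots> = (\<integral>t. ?E t \<partial>lborel) - (\<integral>t. ?E t * ?c t \<partial>lborel)"
      by (rule Bochner_Integration.integral_diff[OF intE int]) (use c01 in auto)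
    finally show ?thesis using has_bochner_integral_integral_eq[OF E] by simp
  qed
  \<comment> \<open>Letting x decrease to y removes the slack.\<close>
  have "f y \<le> (\<integral>t. ?E t * (1 - ?c t) \<partial>lborel)"
  proof (rule tendsto_upperbound)
    have "isCont f y" using d1[OF y] by (rule DERIV_isCont)
    then show "(f \<longlongrightarrow> f y) (at_right y)" by (simp add: isCont_def filterlim_at_split)
    have "f x \<le> (\<integral>t. ?E t * (1 - ?c t) \<partial>lborel)" if "x > y" for x
      using lower[OF that] total by linarith
    then show "\<forall>\<^sub>F x in at_right y. f x \<le> (\<integral>t. ?E t * (1 - ?c t) \<partial>lborel)"
      unfolding eventually_at_right_field by (intro exI[of _ "y + 1"] conjI allI impI) simp_all
  qed simp
  with upper have "(\<integral>t. ?E t * (1 - ?c t) \<partial>lborel) = f y" by simp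
  moreover have "(\<integral>t. ?E t * (1 - ?c t) \<partial>lborel) = lam * laplP M \<mu> \<sigma> W y lam"
    unfolding laplP_def set_lebesgue_integral_def
    by (simp add: mult_ac flip: Bochner_Integration.integral_mult_right_zero)
  ultimately show ?thesis using lam by (simp add: field_simps)
qed

end


text \<open>Treated apart from \<open>laplP_eq\<close>, which concerns y > 0: the functional is
  strictly positive at every t > 0, so the integrand is the bare exponential.\<close>

lemma laplP_0:
  assumes bm: "std_brownian_motion M W" and lam: "lam > 0"
  shows "laplP M \<mu> \<sigma> W 0 lam = 1 / lam"
proof -
  have "cdfI M \<mu> \<sigma> W t 0 = 0" if "t > 0" for t
  proof -
    have "\<not> expfun \<mu> \<sigma> W t \<omega> \<le> 0" if "\<omega> \<in> space M" for \<omega>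
      using expfun_pos[OF bm that \<open>t > 0\<close>, of \<mu> \<sigma>] by simp
    then have "{\<omega> \<in> space M. expfun \<mu> \<sigma> W t \<omega> \<le> 0} = {}" by auto
    then show ?thesis by (simp only: cdfI_def measure_empty)
  qed
  then have "lam * (indicator {0<..} t *\<^sub>R (exp (- lam * t) * (1 - cdfI M \<mu> \<sigma> W t 0)))
      = lam * exp (- lam * t) * indicator {0<..} t" for t
    by (auto simp: indicator_def)
  then have "lam * laplP M \<mu> \<sigma> W 0 lam = (\<integral>t. lam * exp (- lam * t) * indicator {0<..} t \<partial>lborel)"
    unfolding laplP_def set_lebesgue_integral_def by (simp only: integral_mult_right_zero[symmetric])
  also have "\<dots> = 1" by (rule has_bochner_integral_integral_eq[OF has_bochner_integral_exponential[OF lam]])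
  finally show ?thesis using lam by (simp add: field_simps)
qed

section \<open>The explicit parameters and the transfer from f to P\<close>

theorem theorem1:
  fixes M :: "'a measure" and W :: "real \<Rightarrow> 'a \<Rightarrow> real"
    and \<mu> \<sigma> lam :: real
  assumes "\<sigma> > 0" and "std_brownian_motion M W" and "lam > 0"
  defines "P \<equiv> (\<lambda>y. laplP M \<mu> \<sigma> W y lam)"
    and "b \<equiv> \<mu> + \<sigma>\<^sup>2 / 2"
    and "k \<equiv> (\<mu> + sqrt (\<mu>\<^sup>2 + 2 * lam * \<sigma>\<^sup>2)) / \<sigma>\<^sup>2"
  shows "(\<forall>y>0. (P has_real_derivative deriv P y) (at y) \<and>
                (deriv P has_real_derivative deriv (deriv P) y) (at y) \<and>
                1/2 * \<sigma>\<^sup>2 * y\<^sup>2 * deriv (deriv P) y + (b * y - 1) * deriv P y - lam * P y = 0)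
       \<and> P 0 = 1 / lam
       \<and> (P \<longlongrightarrow> 0) at_top
       \<and> (\<forall>y>0. P y = 1 / lam * (2 / (y * \<sigma>\<^sup>2)) powr k
              * Gamma (1 - 2 * \<mu> / \<sigma>\<^sup>2 + k) / Gamma (1 - 2 * \<mu> / \<sigma>\<^sup>2 + 2 * k)
              * kummerM k (1 - 2 * \<mu> / \<sigma>\<^sup>2 + 2 * k) (- 2 / (y * \<sigma>\<^sup>2)))"
proof -
  define \<alpha> where "\<alpha> = \<sigma>\<^sup>2 / 2"
  define c where "c = 1 - 2 * \<mu> / \<sigma>\<^sup>2 + 2 * k"
  define s where "s = sqrt (\<mu>\<^sup>2 + 2 * lam * \<sigma>\<^sup>2)"
  have \<sigma>2: "\<sigma>\<^sup>2 > 0" and \<alpha>: "\<alpha> > 0" using assms(1) by (auto simp: \<alpha>_def)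
  have s2: "s\<^sup>2 = \<mu>\<^sup>2 + 2 * lam * \<sigma>\<^sup>2" using assms(3) by (simp add: s_def)
  have "\<bar>\<mu>\<bar> < s"
  proof -
    have "\<mu>\<^sup>2 < \<mu>\<^sup>2 + 2 * lam * \<sigma>\<^sup>2" using assms(3) \<sigma>2 by simp
    then show ?thesis unfolding s_def by (simp only: real_sqrt_abs[symmetric] real_sqrt_less_iff)
  qed
  then have ms: "0 < \<mu> + s" "0 < s - \<mu>" by linarith+
  have k_eq: "k = (\<mu> + s) / \<sigma>\<^sup>2" by (simp add: k_def s_def)
  have k: "k > 0" using ms \<sigma>2 by (simp add: k_eq)
  \<comment> \<open>Positivity of s - \<mu> puts (k, c) in the range c > k + 1 of
    \<open>kummerM_asymptotics\<close>, which gives the limit at 0.\<close>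
  have ck: "c - k = 1 + (s - \<mu>) / \<sigma>\<^sup>2"
    by (simp add: c_def k_eq add_divide_distrib diff_divide_distrib)
  then have ck1: "c > k + 1" using divide_pos_pos[OF ms(2) \<sigma>2] by linarith
  then have c: "c > 0" using k by simp
  have c_\<alpha>: "c = 1 - \<mu> / \<alpha> + 2 * k" using \<sigma>2 by (simp add: c_def \<alpha>_def)
  \<comment> \<open>\<open>k\<close> is the positive root of \<alpha> k^2 - \<mu> k = lam, the
    eigenvalue condition of \<open>kummerG_ode\<close>.\<close>
  have lam_eq: "\<alpha> * k\<^sup>2 - \<mu> * k = lam"
  proof -
    have "\<sigma>\<^sup>2 * k = \<mu> + s" using \<sigma>2 by (simp add: k_eq)
    moreover have "\<alpha> * k\<^sup>2 - \<mu> * k = (\<sigma>\<^sup>2 * k) * (\<sigma>\<^sup>2 * k - 2 * \<mu>) / (2 * \<sigma>\<^sup>2)"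
    proof -
      have "q * k * (q * k - 2 * \<mu>) / (2 * q) = q / 2 * k\<^sup>2 - \<mu> * k" if "q > 0" for q
        using that by (simp add: field_simps power2_eq_square)
      from this[OF \<sigma>2] show ?thesis by (simp only: \<alpha>_def)
    qed
    ultimately have "\<alpha> * k\<^sup>2 - \<mu> * k = (s\<^sup>2 - \<mu>\<^sup>2) / (2 * \<sigma>\<^sup>2)"
      by (simp add: power2_eq_square algebra_simps)
    then show ?thesis unfolding s2 using \<sigma>2 by simp
  qed
  \<comment> \<open>\<open>A\<close> normalises the limit at 0 to 1 and is the Gamma quotient of the
    claimed formula.\<close>
  define A where "A = Gamma (c - k) / Gamma c"
  have Gpos: "Gamma (c - k) > 0" "Gamma c > 0" by (rule Gamma_real_pos, use ck1 k c in linarith)+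
  define f where "f x = A * kummerG \<alpha> c k x" for x
  define f1 where "f1 x = A * (- \<alpha> * k * kummerG \<alpha> c (k + 1) x)" for x
  define f2 where "f2 x = A * (- \<alpha> * k * (- \<alpha> * (k + 1) * kummerG \<alpha> c (k + 2) x))" for x
  define f3 where "f3 x = A * (- \<alpha> * k * (- \<alpha> * (k + 1) * (- \<alpha> * (k + 2) * kummerG \<alpha> c (k + 3) x)))" for x
  have dG: "(kummerG \<alpha> c (k + real j) has_real_derivative - \<alpha> * (k + real j) * kummerG \<alpha> c (k + real (Suc j)) x) (at x)"
    if "x > 0" for x j
    using kummerG_has_derivative[OF \<alpha> c _ that, of "k + real j"] k by (simp add: add_ac)
  have d1: "(f has_real_derivative f1 x) (at x)" if "x > 0" for x
    unfolding f_def[abs_def] f1_def using dG[OF that, of 0] by (intro DERIV_cmult) simp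
  have d2: "(f1 has_real_derivative f2 x) (at x)" if "x > 0" for x
    unfolding f1_def[abs_def] f2_def using dG[OF that, of 1] by (intro DERIV_cmult) simp
  have d3: "(f2 has_real_derivative f3 x) (at x)" if "x > 0" for x
    unfolding f2_def[abs_def] f3_def using dG[OF that, of 2] by (intro DERIV_cmult) simp
  have cmult: "\<exists>B. \<forall>x>0. \<bar>g x\<bar> \<le> B" if u: "\<exists>B. \<forall>x>0. \<bar>u x\<bar> \<le> B" and g: "\<And>x. g x = m * u x"
    for u g :: "real \<Rightarrow> real" and m
  proof -
    obtain B where "\<forall>x>0. \<bar>u x\<bar> \<le> B" using u by blast
    then have "\<forall>x>0. \<bar>g x\<bar> \<le> \<bar>m\<bar> * B" by (auto simp: g abs_mult intro: mult_left_mono)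
    then show ?thesis by blast
  qed
  note bG = kummerG_bounded[OF \<alpha> c] and bxG = kummerG_power_bounded[OF \<alpha> c k]
  have "\<exists>B. \<forall>x>0. \<bar>f x\<bar> \<le> B"
    by (rule cmult[OF bG[of k], of _ A]) (use k in \<open>auto simp: f_def\<close>)
  then obtain b0 where b0: "\<And>x. x > 0 \<Longrightarrow> \<bar>f x\<bar> \<le> b0" by blast
  have "\<exists>B. \<forall>x>0. \<bar>f1 x\<bar> \<le> B"
    by (rule cmult[OF bG[of "k + 1"], of _ "A * (- \<alpha> * k)"]) (use k in \<open>auto simp: f1_def\<close>)
  then obtain b1 where b1: "\<And>x. x > 0 \<Longrightarrow> \<bar>f1 x\<bar> \<le> b1" by blast
  have "\<exists>B. \<forall>x>0. \<bar>f2 x\<bar> \<le> B"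
    by (rule cmult[OF bG[of "k + 2"], of _ "A * (- \<alpha> * k * (- \<alpha> * (k + 1)))"])
      (use k in \<open>auto simp: f2_def mult_ac\<close>)
  then obtain b2 where b2: "\<And>x. x > 0 \<Longrightarrow> \<bar>f2 x\<bar> \<le> b2" by blast
  have "\<exists>B. \<forall>x>0. \<bar>x * f1 x\<bar> \<le> B"
    by (rule cmult[OF bxG[of 1], of _ "A * (- \<alpha> * k)"]) (simp add: f1_def mult_ac)
  then obtain b3 where b3: "\<And>x. x > 0 \<Longrightarrow> \<bar>x * f1 x\<bar> \<le> b3" by blast
  have "\<exists>B. \<forall>x>0. \<bar>x\<^sup>2 * f2 x\<bar> \<le> B"
    by (rule cmult[OF bxG[of 2], of _ "A * (- \<alpha> * k * (- \<alpha> * (k + 1)))"]) (simp add: f2_def mult_ac)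
  then obtain b4 where b4: "\<And>x. x > 0 \<Longrightarrow> \<bar>x\<^sup>2 * f2 x\<bar> \<le> b4" by blast
  have "\<exists>B. \<forall>x>0. \<bar>x ^ 3 * f3 x\<bar> \<le> B"
    by (rule cmult[OF bxG[of 3], of _ "A * (- \<alpha> * k * (- \<alpha> * (k + 1) * (- \<alpha> * (k + 2))))"])
      (simp add: f3_def mult_ac)
  then obtain b5 where b5: "\<And>x. x > 0 \<Longrightarrow> \<bar>x ^ 3 * f3 x\<bar> \<le> b5" by blast
  define B where "B = Max {b0, b1, b2, b3, b4, b5}"
  have leB: "b0 \<le> B" "b1 \<le> B" "b2 \<le> B" "b3 \<le> B" "b4 \<le> B" "b5 \<le> B"
    unfolding B_def by (rule Max_ge; simp)+
  have ode: "1/2 * \<sigma>\<^sup>2 * x\<^sup>2 * f2 x + ((\<mu> + \<sigma>\<^sup>2 / 2) * x - 1) * f1 x - lam * f x = 0" if "x > 0" for x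
  proof -
    have half: "1/2 * \<sigma>\<^sup>2 = \<alpha>" by (simp add: \<alpha>_def)
    have "A * (\<alpha> * x\<^sup>2 * (\<alpha>\<^sup>2 * k * (k + 1) * kummerG \<alpha> c (k + 2) x)
        + ((\<mu> + \<alpha>) * x - 1) * (- \<alpha> * k * kummerG \<alpha> c (k + 1) x)) = A * (lam * kummerG \<alpha> c k x)"
      using kummerG_ode[OF \<alpha> c k that c_\<alpha>] unfolding lam_eq by simp
    then show ?thesis
      unfolding half f_def f1_def f2_def \<alpha>_def[symmetric]
      by (simp add: power2_eq_square algebra_simps)
  qed
  have at_0: "(f \<longlongrightarrow> 1) (at_right 0)"
  proof -
    have "((\<lambda>x. A * kummerG \<alpha> c k x) \<longlongrightarrow> A * (Gamma c / Gamma (c - k))) (at_right 0)"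
      by (intro tendsto_mult tendsto_const kummerG_at_right_0 \<alpha> k ck1)
    moreover have "A * (Gamma c / Gamma (c - k)) = 1" using Gpos by (simp add: A_def)
    ultimately show ?thesis by (simp only: f_def[abs_def])
  qed
  interpret resolvent_solution f f1 f2 f3 \<mu> \<sigma> lam B
  proof
    fix x :: real assume x: "x > 0"
    show "\<bar>f x\<bar> \<le> B" "\<bar>f1 x\<bar> \<le> B" "\<bar>f2 x\<bar> \<le> B" "\<bar>x * f1 x\<bar> \<le> B" "\<bar>x\<^sup>2 * f2 x\<bar> \<le> B" "\<bar>x ^ 3 * f3 x\<bar> \<le> B"
      using b0[OF x] b1[OF x] b2[OF x] b3[OF x] b4[OF x] b5[OF x] leB by (blast intro: order_trans)+
  qed (fact assms d1 d2 d3 ode at_0)+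
  have P: "P y = f y / lam" if "y > 0" for y
    unfolding P_def by (rule laplP_eq[OF assms(2) that])
  have ev: "\<forall>\<^sub>F x in nhds y. x > 0" if "y > 0" for y :: real
    using that by (rule eventually_nhds_in_open[OF open_greaterThan, simplified])
  have P1: "(P has_real_derivative f1 y / lam) (at y)" if y: "y > 0" for y
  proof -
    \<comment> \<open>\<open>P\<close> agrees with f / lam only on the positive half-line, so
      derivatives are transferred through a neighbourhood of y.\<close>
    have "\<forall>\<^sub>F x in nhds y. P x = f x / lam" using ev[OF y] by (rule eventually_mono) (rule P)
    from DERIV_cong_ev[OF refl this refl] DERIV_cdivide[OF d1[OF y], of lam] show ?thesis by (rule iffD2)
  qed
  then have dP: "deriv P y = f1 y / lam" if "y > 0" for y using that by (intro DERIV_imp_deriv)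
  have P2: "(deriv P has_real_derivative f2 y / lam) (at y)" if y: "y > 0" for y
  proof -
    have "\<forall>\<^sub>F x in nhds y. deriv P x = f1 x / lam" using ev[OF y] by (rule eventually_mono) (rule dP)
    from DERIV_cong_ev[OF refl this refl] DERIV_cdivide[OF d2[OF y], of lam] show ?thesis by (rule iffD2)
  qed
  then have ddP: "deriv (deriv P) y = f2 y / lam" if "y > 0" for y using that by (intro DERIV_imp_deriv)
  have "1/2 * \<sigma>\<^sup>2 * y\<^sup>2 * deriv (deriv P) y + (b * y - 1) * deriv P y - lam * P y = 0" if y: "y > 0" for y
  proof -
    have "1/2 * \<sigma>\<^sup>2 * y\<^sup>2 * (f2 y / lam) + (b * y - 1) * (f1 y / lam) - lam * (f y / lam)
        = (1/2 * \<sigma>\<^sup>2 * y\<^sup>2 * f2 y + (b * y - 1) * f1 y - lam * f y) / lam"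
      by (simp add: add_divide_distrib diff_divide_distrib)
    also have "\<dots> = 0" using ode[OF y] by (simp add: b_def)
    finally show ?thesis using P dP ddP y by simp
  qed
  moreover have "(P \<longlongrightarrow> 0) at_top"
  proof -
    have "((\<lambda>x. A * kummerG \<alpha> c k x / lam) \<longlongrightarrow> A * 0 / lam) at_top"
      using assms(3) by (intro tendsto_intros kummerG_at_top \<alpha> k c) auto
    moreover have "\<forall>\<^sub>F x in at_top. A * kummerG \<alpha> c k x / lam = P x"
      using eventually_gt_at_top[of 0] by eventually_elim (simp add: P f_def)
    ultimately show ?thesis using Lim_transform_eventually by fastforce
  qed
  moreover have "P y = 1 / lam * (2 / (y * \<sigma>\<^sup>2)) powr k * Gamma (1 - 2 * \<mu> / \<sigma>\<^sup>2 + k) / Gamma (1 - 2 * \<mu> / \<sigma>\<^sup>2 + 2 * k)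
      * kummerM k (1 - 2 * \<mu> / \<sigma>\<^sup>2 + 2 * k) (- 2 / (y * \<sigma>\<^sup>2))" if y: "y > 0" for y
  proof -
    have z: "1 / (\<alpha> * y) = 2 / (y * \<sigma>\<^sup>2)" by (simp add: \<alpha>_def mult.commute)
    have ck': "1 - 2 * \<mu> / \<sigma>\<^sup>2 + k = c - k" by (simp add: c_def)
    show ?thesis unfolding P[OF y] f_def kummerG_def A_def c_def[symmetric] z ck' by (simp add: mult_ac)
  qed
  moreover have "P 0 = 1 / lam" unfolding P_def by (rule laplP_0[OF assms(2,3)])
  moreover have "(P has_real_derivative deriv P y) (at y)" "(deriv P has_real_derivative deriv (deriv P) y) (at y)"
    if "y > 0" for y
    using P1[OF that] P2[OF that] dP[OF that] ddP[OF that] by simp_all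
  ultimately show ?thesis by blast
qed

end
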